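(* Let $M$ be a compact smooth manifold, $r\ge1$, $g$ a Riemannian metric on $M$, $f:M\to M$ a $C^k$ diffeomorphism with $k\ge r+1$, and $f^*g$ the pullback metric. Let $V$ be a type of norm on $C^r(TM)$ (such as $C^l$ for $0\le l\le r$, or Sobolev $H^l$ for $l\le r$) whose definition depends on a Riemannian metric, written $\|\cdot\|_{V,g}$, respectively $\|\cdot\|_{V,f^*g}$. Assume that the pushforward $f_*:C^r(TM)\to C^r(TM)$, $(f_*Y)(y)=Df_{f^{-1}(y)}\bigl(Y(f^{-1}(y))\bigr)$, satisfies $$\|f_*Y\|_{V,f^*g}=\|Y\|_{V,g}\qquad\text{for all } Y\in C^r(TM).$$ Let $d_{\mathrm{An},V,g}$ and $d_{\mathrm{An},V,f^*g}$ be the Hofer-like metrics on $\mathrm{An}(M)$ defined by the norms $\|\cdot\|_{V,g}$ and $\|\cdot\|_{V,f^*g}$ respectively. Then for all $X,Z\in\mathrm{An}(M)$, $$d_{\mathrm{An},V,f^*g}(f_*X,f_*Z)=d_{\mathrm{An},V,g}(X,Z).$$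
   Context: A flow $\varphi^t$ on $M$ generated by $X\in C^r(TM)$ ($r\ge1$) is Anosov if there are a continuous $d\varphi^t$-invariant splitting $TM=E^s\oplus E^u\oplus\mathbb{R}X$ and constants $C,\lambda>0$ such that for all $t>0$, $\|d\varphi^tv\|\le Ce^{-\lambda t}\|v\|$ for $v\in E^s$ and $\|d\varphi^{-t}v\|\le Ce^{-\lambda t}\|v\|$ for $v\in E^u$ (norms from an auxiliary Riemannian metric). $\mathrm{An}(M)\subset C^r(TM)$ is the (open) set of $C^r$ vector fields generating Anosov flows. For a norm $\|\cdot\|_{V}$ on vector fields, the Hofer-like distance is $d_{\mathrm{An},V}(X_0,X_1)=\inf\int_0^1\|dX_s/ds\|_{V}\,ds$, the infimum being over all $C^1$ paths $s\mapsto X_s$, $[0,1]\to\mathrm{An}(M)$, from $X_0$ to $X_1$ (and $\infty$ if $X_0,X_1$ lie in different path components). *)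

theory Defs
  imports "HOL-Analysis.Analysis"
begin

section \<open>Differentiability classes in Euclidean space\<close>

text \<open>Iterated directional derivatives, the last vector of the list being applied first.\<close>

fun dir_deriv :: "'e::real_normed_vector list \<Rightarrow> ('e \<Rightarrow> 'f::real_normed_vector) \<Rightarrow> 'e \<Rightarrow> 'f" where
  "dir_deriv [] f = f"
| "dir_deriv (v # vs) f = (\<lambda>x. frechet_derivative (dir_deriv vs f) (at x) v)"

text \<open>Only used for open \<open>S\<close> in a finite-dimensional space.\<close>

definition Ck_on :: "nat \<Rightarrow> 'e::euclidean_space set \<Rightarrow> ('e \<Rightarrow> 'f::real_normed_vector) \<Rightarrow> bool" where
  "Ck_on k S f \<longleftrightarrow>
     (\<forall>vs. length vs < k \<longrightarrow> (\<forall>x\<in>S. dir_deriv vs f differentiable (at x))) \<and>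
     (\<forall>vs. length vs \<le> k \<longrightarrow> continuous_on S (dir_deriv vs f))"

section \<open>Smooth manifolds\<close>

text \<open>A chart is a domain together with a coordinate map; the values of the map outside the
  domain are irrelevant. The dimension of the manifold is \<open>DIM('e) \<ge> 1\<close>.\<close>

type_synonym ('a, 'e) chart = "'a set \<times> ('a \<Rightarrow> 'e)"

abbreviation cdom :: "('a, 'e) chart \<Rightarrow> 'a set" where "cdom c \<equiv> fst c"
abbreviation cmap :: "('a, 'e) chart \<Rightarrow> 'a \<Rightarrow> 'e" where "cmap c \<equiv> snd c"
abbreviation cimg :: "('a, 'e) chart \<Rightarrow> 'e set" where "cimg c \<equiv> cmap c ` cdom c"

definition cinv :: "('a, 'e) chart \<Rightarrow> 'e \<Rightarrow> 'a" where
  "cinv c = inv_into (cdom c) (cmap c)"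

text \<open>The atlas \<open>A\<close> need not be maximal. Manifolds have no boundary.\<close>

definition smooth_manifold :: "'a topology \<Rightarrow> ('a, 'e::euclidean_space) chart set \<Rightarrow> bool" where
  "smooth_manifold T A \<longleftrightarrow>
     Hausdorff_space T \<and> second_countable T \<and>
     (\<Union>c\<in>A. cdom c) = topspace T \<and>
     (\<forall>c\<in>A. openin T (cdom c) \<and> open (cimg c) \<and>
        homeomorphic_map (subtopology T (cdom c)) (top_of_set (cimg c)) (cmap c)) \<and>
     (\<forall>c\<in>A. \<forall>c'\<in>A. \<forall>m. Ck_on m (cmap c ` (cdom c \<inter> cdom c')) (cmap c' \<circ> cinv c))"

definition charts_at :: "('a, 'e) chart set \<Rightarrow> 'a \<Rightarrow> ('a, 'e) chart set" where
  "charts_at A x = {c \<in> A. x \<in> cdom c}"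

section \<open>Tangent vectors and tangent maps\<close>

text \<open>A tangent vector at \<open>x\<close> is given by its coordinate representatives in all charts around
  \<open>x\<close>, related by the derivatives of the transition maps. Representatives in other charts are
  set to zero, so that equal vectors are equal functions. In particular, the only element of
  \<open>tangent_space A x\<close> for \<open>x\<close> outside of the manifold is zero.\<close>

type_synonym ('a, 'e) tvec = "('a, 'e) chart \<Rightarrow> 'e"
type_synonym ('a, 'e) vfield = "'a \<Rightarrow> ('a, 'e) tvec"
type_synonym ('a, 'e) metric_tensor = "'a \<Rightarrow> ('a, 'e) tvec \<Rightarrow> ('a, 'e) tvec \<Rightarrow> real"

definition tangent_space :: "('a, 'e::euclidean_space) chart set \<Rightarrow> 'a \<Rightarrow> ('a, 'e) tvec set" where
  "tangent_space A x =
     {v. (\<forall>c. c \<notin> charts_at A x \<longrightarrow> v c = 0) \<and>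
         (\<forall>c\<in>charts_at A x. \<forall>c'\<in>charts_at A x.
            v c' = frechet_derivative (cmap c' \<circ> cinv c) (at (cmap c x)) (v c))}"

definition tv_zero :: "('a, 'e::euclidean_space) tvec" where
  "tv_zero = (\<lambda>c. 0)"

definition tv_add :: "('a, 'e::euclidean_space) tvec \<Rightarrow> ('a, 'e) tvec \<Rightarrow> ('a, 'e) tvec" where
  "tv_add u v = (\<lambda>c. u c + v c)"

definition tv_scale :: "real \<Rightarrow> ('a, 'e::euclidean_space) tvec \<Rightarrow> ('a, 'e) tvec" where
  "tv_scale a v = (\<lambda>c. a *\<^sub>R v c)"

text \<open>The tangent vector at \<open>x\<close> with representative \<open>a\<close> in the chart \<open>c\<close>.\<close>

definition coord_vec ::
  "('a, 'e::euclidean_space) chart set \<Rightarrow> ('a, 'e) chart \<Rightarrow> 'a \<Rightarrow> 'e \<Rightarrow> ('a, 'e) tvec" where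
  "coord_vec A c x a =
     (\<lambda>c'. if c' \<in> charts_at A x
           then frechet_derivative (cmap c' \<circ> cinv c) (at (cmap c x)) a else 0)"

definition Ck_map ::
  "'a topology \<Rightarrow> ('a, 'e::euclidean_space) chart set \<Rightarrow> nat \<Rightarrow> ('a \<Rightarrow> 'a) \<Rightarrow> bool" where
  "Ck_map T A k f \<longleftrightarrow>
     continuous_map T T f \<and>
     (\<forall>c\<in>A. \<forall>c'\<in>A. Ck_on k (cmap c ` {x \<in> cdom c. f x \<in> cdom c'}) (cmap c' \<circ> f \<circ> cinv c))"

definition Ck_diffeo ::
  "'a topology \<Rightarrow> ('a, 'e::euclidean_space) chart set \<Rightarrow> nat \<Rightarrow> ('a \<Rightarrow> 'a) \<Rightarrow> bool" where
  "Ck_diffeo T A k f \<longleftrightarrow>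
     bij_betw f (topspace T) (topspace T) \<and>
     Ck_map T A k f \<and> Ck_map T A k (inv_into (topspace T) f)"

text \<open>For \<open>v \<in> tangent_space A x\<close> and \<open>f\<close> differentiable at \<open>x\<close>, the chosen chart \<open>c\<close> is
  immaterial, by the chain rule.\<close>

definition tangent_map ::
  "('a, 'e::euclidean_space) chart set \<Rightarrow> ('a \<Rightarrow> 'a) \<Rightarrow> 'a \<Rightarrow> ('a, 'e) tvec \<Rightarrow> ('a, 'e) tvec" where
  "tangent_map A f x v =
     (let c = (SOME c. c \<in> charts_at A x) in
      (\<lambda>c'. if c' \<in> charts_at A (f x)
            then frechet_derivative (cmap c' \<circ> f \<circ> cinv c) (at (cmap c x)) (v c) else 0))"

section \<open>Vector fields\<close>

definition local_rep :: "('a, 'e) chart \<Rightarrow> ('a, 'e) vfield \<Rightarrow> 'e \<Rightarrow> 'e" where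
  "local_rep c X = (\<lambda>p. X (cinv c p) c)"

text \<open>\<open>C\<^sup>r(TM)\<close>; note that its elements vanish outside of the manifold.\<close>

definition Cr_fields :: "('a, 'e::euclidean_space) chart set \<Rightarrow> nat \<Rightarrow> ('a, 'e) vfield set" where
  "Cr_fields A r =
     {X. (\<forall>x. X x \<in> tangent_space A x) \<and> (\<forall>c\<in>A. Ck_on r (cimg c) (local_rep c X))}"

definition pushforward ::
  "'a topology \<Rightarrow> ('a, 'e::euclidean_space) chart set \<Rightarrow> ('a \<Rightarrow> 'a) \<Rightarrow>
     ('a, 'e) vfield \<Rightarrow> ('a, 'e) vfield" where
  "pushforward T A f Y =
     (\<lambda>y. if y \<in> topspace T
          then let x = inv_into (topspace T) f y in tangent_map A f x (Y x)
          else tv_zero)"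

definition norm_on :: "('a, 'e::euclidean_space) vfield set \<Rightarrow> (('a, 'e) vfield \<Rightarrow> real) \<Rightarrow> bool" where
  "norm_on W N \<longleftrightarrow>
     (\<forall>X\<in>W. N X \<ge> 0 \<and> (N X = 0 \<longleftrightarrow> X = (\<lambda>x. tv_zero))) \<and>
     (\<forall>X\<in>W. \<forall>a. N (\<lambda>x. tv_scale a (X x)) = \<bar>a\<bar> * N X) \<and>
     (\<forall>X\<in>W. \<forall>Y\<in>W. N (\<lambda>x. tv_add (X x) (Y x)) \<le> N X + N Y)"

text \<open>Convergence in the \<open>C\<^sup>r\<close> topology: uniform convergence of all derivatives of order at most
  \<open>r\<close> of the local representatives, on compact subsets of the charts. On a compact manifold
  this is convergence in the Banach space \<open>C\<^sup>r(TM)\<close>.\<close>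

definition Cr_tendsto ::
  "('a, 'e::euclidean_space) chart set \<Rightarrow> nat \<Rightarrow> ('b \<Rightarrow> ('a, 'e) vfield) \<Rightarrow> ('a, 'e) vfield \<Rightarrow>
     'b filter \<Rightarrow> bool" where
  "Cr_tendsto A r F X G \<longleftrightarrow>
     (\<forall>c\<in>A. \<forall>K. compact K \<and> K \<subseteq> cimg c \<longrightarrow>
        (\<forall>vs. length vs \<le> r \<longrightarrow>
           uniform_limit K (\<lambda>s. dir_deriv vs (local_rep c (F s))) (dir_deriv vs (local_rep c X)) G))"

section \<open>Riemannian metrics\<close>

text \<open>Riemannian metrics of class \<open>C\<^sup>m\<close>, tested on the constant coordinate vector fields.
  Values on arguments outside of the tangent spaces are normalised to zero.\<close>

definition riemannian_metric ::
  "('a, 'e::euclidean_space) chart set \<Rightarrow> nat \<Rightarrow> ('a, 'e) metric_tensor \<Rightarrow> bool" where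
  "riemannian_metric A m g \<longleftrightarrow>
     (\<forall>x u v. \<not> (u \<in> tangent_space A x \<and> v \<in> tangent_space A x) \<longrightarrow> g x u v = 0) \<and>
     (\<forall>x. \<forall>u\<in>tangent_space A x. \<forall>v\<in>tangent_space A x. g x u v = g x v u) \<and>
     (\<forall>x. \<forall>u\<in>tangent_space A x. \<forall>v\<in>tangent_space A x. \<forall>w\<in>tangent_space A x. \<forall>a b.
        g x (tv_add (tv_scale a u) (tv_scale b v)) w = a * g x u w + b * g x v w) \<and>
     (\<forall>x. \<forall>u\<in>tangent_space A x. u \<noteq> tv_zero \<longrightarrow> g x u u > 0) \<and>
     (\<forall>c\<in>A. \<forall>a b. Ck_on m (cimg c)
        (\<lambda>p. g (cinv c p) (coord_vec A c (cinv c p) a) (coord_vec A c (cinv c p) b)))"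

definition metric_norm :: "('a, 'e) metric_tensor \<Rightarrow> 'a \<Rightarrow> ('a, 'e) tvec \<Rightarrow> real" where
  "metric_norm g x v = sqrt (g x v v)"

definition pullback_metric ::
  "'a topology \<Rightarrow> ('a, 'e::euclidean_space) chart set \<Rightarrow> ('a \<Rightarrow> 'a) \<Rightarrow>
     ('a, 'e) metric_tensor \<Rightarrow> ('a, 'e) metric_tensor" where
  "pullback_metric T A f g =
     (\<lambda>x u v. if x \<in> topspace T \<and> u \<in> tangent_space A x \<and> v \<in> tangent_space A x
              then g (f x) (tangent_map A f x u) (tangent_map A f x v) else 0)"

section \<open>Anosov vector fields\<close>

text \<open>\<open>\<phi>\<close> is the flow generated by the \<open>C\<^sup>r\<close> vector field \<open>X\<close>. For \<open>r \<ge> 1\<close> on a compact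
  manifold it exists and is unique; the group law, the joint continuity and the
  \<open>C\<^sup>r\<close> regularity of \<open>\<phi> t\<close> then follow from the theory of ordinary differential equations.\<close>

definition flow_of ::
  "'a topology \<Rightarrow> ('a, 'e::euclidean_space) chart set \<Rightarrow> nat \<Rightarrow> ('a, 'e) vfield \<Rightarrow>
     (real \<Rightarrow> 'a \<Rightarrow> 'a) \<Rightarrow> bool" where
  "flow_of T A r X \<phi> \<longleftrightarrow>
     continuous_map (prod_topology euclideanreal T) T (\<lambda>(t, x). \<phi> t x) \<and>
     (\<forall>t. Ck_map T A r (\<phi> t)) \<and>
     (\<forall>x\<in>topspace T. \<phi> 0 x = x) \<and>
     (\<forall>x\<in>topspace T. \<forall>s t. \<phi> (s + t) x = \<phi> s (\<phi> t x)) \<and>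
     (\<forall>x\<in>topspace T. \<forall>t. \<forall>c\<in>charts_at A (\<phi> t x).
        ((\<lambda>s. cmap c (\<phi> s x)) has_vector_derivative X (\<phi> t x) c) (at t))"

text \<open>Continuous subbundles of the tangent bundle, by means of continuous local frames
  \<open>F 0, \<dots>, F (m - 1)\<close>.\<close>

definition continuous_subbundle ::
  "'a topology \<Rightarrow> ('a, 'e::euclidean_space) chart set \<Rightarrow> ('a \<Rightarrow> ('a, 'e) tvec set) \<Rightarrow> bool" where
  "continuous_subbundle T A E \<longleftrightarrow>
     (\<forall>x0\<in>topspace T. \<exists>U (m::nat) F.
        openin T U \<and> x0 \<in> U \<and>
        (\<forall>i<m. (\<forall>x\<in>U. F i x \<in> tangent_space A x) \<and>
               (\<forall>c\<in>A. continuous_map (subtopology T (U \<inter> cdom c)) euclidean (\<lambda>x. F i x c))) \<and>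
        (\<forall>x\<in>U. E x = range (\<lambda>a::nat \<Rightarrow> real. \<lambda>c. \<Sum>i<m. a i *\<^sub>R F i x c) \<and>
               (\<forall>a::nat \<Rightarrow> real.
                  (\<lambda>c. \<Sum>i<m. a i *\<^sub>R F i x c) = tv_zero \<longrightarrow> (\<forall>i<m. a i = 0))))"

text \<open>\<open>TM = E\<^sup>s \<oplus> E\<^sup>u \<oplus> \<real>X\<close>; uniqueness of the coefficient of \<open>X\<close> says that
  \<open>X\<close> has no zeros, so that \<open>\<real>X\<close> is a line bundle.\<close>

definition flow_splitting ::
  "'a topology \<Rightarrow> ('a, 'e::euclidean_space) chart set \<Rightarrow> ('a, 'e) vfield \<Rightarrow>
     ('a \<Rightarrow> ('a, 'e) tvec set) \<Rightarrow> ('a \<Rightarrow> ('a, 'e) tvec set) \<Rightarrow> bool" where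
  "flow_splitting T A X Es Eu \<longleftrightarrow>
     continuous_subbundle T A Es \<and> continuous_subbundle T A Eu \<and>
     (\<forall>x\<in>topspace T. \<forall>v\<in>tangent_space A x. \<exists>!(u, w, a).
        u \<in> Es x \<and> w \<in> Eu x \<and> v = tv_add (tv_add u w) (tv_scale a (X x)))"

text \<open>On a compact manifold the choice of the auxiliary metric \<open>h\<close>, and its
  regularity, only affect the constant \<open>C\<close>.\<close>

definition Anosov_fields ::
  "'a topology \<Rightarrow> ('a, 'e::euclidean_space) chart set \<Rightarrow> nat \<Rightarrow> ('a, 'e) vfield set" where
  "Anosov_fields T A r =
     {X \<in> Cr_fields A r. \<exists>\<phi> Es Eu h C l.
        flow_of T A r X \<phi> \<and> flow_splitting T A X Es Eu \<and>
        (\<forall>t. \<forall>x\<in>topspace T.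
           tangent_map A (\<phi> t) x ` Es x = Es (\<phi> t x) \<and>
           tangent_map A (\<phi> t) x ` Eu x = Eu (\<phi> t x)) \<and>
        riemannian_metric A r h \<and> (C::real) > 0 \<and> (l::real) > 0 \<and>
        (\<forall>t>0. \<forall>x\<in>topspace T.
           (\<forall>v\<in>Es x. metric_norm h (\<phi> t x) (tangent_map A (\<phi> t) x v)
              \<le> C * exp (- l * t) * metric_norm h x v) \<and>
           (\<forall>v\<in>Eu x. metric_norm h (\<phi> (- t) x) (tangent_map A (\<phi> (- t)) x v)
              \<le> C * exp (- l * t) * metric_norm h x v))}"

section \<open>The Hofer-like distance\<close>

text \<open>\<open>P\<close> restricted to \<open>[0,1]\<close> is a path in \<open>An(M)\<close> that is \<open>C\<^sup>1\<close> as a map into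
  \<open>C\<^sup>r(TM)\<close>, with derivative \<open>P'\<close> (one-sided at the end points).\<close>

definition Anosov_C1_path ::
  "'a topology \<Rightarrow> ('a, 'e::euclidean_space) chart set \<Rightarrow> nat \<Rightarrow>
     (real \<Rightarrow> ('a, 'e) vfield) \<Rightarrow> (real \<Rightarrow> ('a, 'e) vfield) \<Rightarrow> bool" where
  "Anosov_C1_path T A r P P' \<longleftrightarrow>
     (\<forall>s\<in>{0..1}. P s \<in> Anosov_fields T A r \<and> P' s \<in> Cr_fields A r \<and>
        Cr_tendsto A r (\<lambda>t x c. (P t x c - P s x c) /\<^sub>R (t - s)) (P' s) (at s within {0..1}) \<and>
        Cr_tendsto A r P' (P' s) (at s within {0..1}))"

text \<open>The infimum over the empty set is \<open>\<infinity>\<close>. For a norm \<open>N\<close> that is continuous in the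
  \<open>C\<^sup>r\<close> topology, such as a \<open>C\<^sup>l\<close> or \<open>H\<^sup>l\<close> norm with \<open>l \<le> r\<close>, the integrand is continuous
  and the integral is the Riemann integral.\<close>

definition hofer_dist ::
  "'a topology \<Rightarrow> ('a, 'e::euclidean_space) chart set \<Rightarrow> nat \<Rightarrow> (('a, 'e) vfield \<Rightarrow> real) \<Rightarrow>
     ('a, 'e) vfield \<Rightarrow> ('a, 'e) vfield \<Rightarrow> ennreal" where
  "hofer_dist T A r N X0 X1 =
     Inf {\<integral>\<^sup>+ s\<in>{0..1}. ennreal (N (P' s)) \<partial>lborel | P P'.
            Anosov_C1_path T A r P P' \<and> P 0 = X0 \<and> P 1 = X1}"

end

theory Submission
  imports Defs
begin

text \<open>A diffeomorphism \<open>f\<close> transports every ingredient of the distance. If \<open>\<phi>\<close> is the flow of \<open>X\<close>, then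
\<open>f \<circ> \<phi> t \<circ> f\<^sup>-\<^sup>1\<close> is the flow of \<open>f\<^sub>*X\<close>; if \<open>TM = E\<^sup>s \<oplus> E\<^sup>u \<oplus> \<real>X\<close> is the Anosov splitting, then
\<open>Df E\<^sup>s \<oplus> Df E\<^sup>u \<oplus> \<real>f\<^sub>*X\<close> is invariant under the conjugate flow; and with respect to the pullback of the
auxiliary metric by \<open>f\<^sup>-\<^sup>1\<close> the map \<open>Df\<close> is an isometry, so that the constants \<open>C\<close> and \<open>\<lambda>\<close> stay the
same. Hence \<open>f\<^sub>*\<close> maps \<open>An(M)\<close> to itself (\<open>pushforward_Anosov\<close>).

Moreover \<open>f\<^sub>*\<close> is linear and continuous in the \<open>C\<^sup>r\<close> topology (\<open>pushforward_Cr_tendsto\<close>). It therefore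
commutes with the derivative of a path and maps \<open>C\<^sup>1\<close> paths of Anosov fields to such paths
(\<open>pushforward_path\<close>). By the assumption on the norms the image path has the same length, which gives
\<open>d(f\<^sub>*X, f\<^sub>*Z) \<le> d(X, Z)\<close>. The inverse of \<open>f\<close> satisfies the same hypotheses with the two norms
interchanged, and \<open>f\<^sub>*\<close> is inverted by \<open>(f\<^sup>-\<^sup>1)\<^sub>*\<close>; so the same inequality for \<open>f\<^sup>-\<^sup>1\<close> is the reverse one.

In coordinates \<open>f\<^sub>*Y\<close> is \<open>q \<mapsto> DF(G q) (Y (G q))\<close>, where \<open>F\<close> and \<open>G\<close> are the coordinate expressions of \<open>f\<close> and
\<open>f\<^sup>-\<^sup>1\<close>. The regularity and the continuity of \<open>f\<^sub>*\<close> thus reduce to the stability of \<open>C\<^sup>r\<close> functions, and of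
\<open>C\<^sup>r\<close> limits, under composition with a fixed map and application of a fixed derivative. The latter
is where \<open>f\<close> has to be of class \<open>C\<^bsup>r+1\<^esup>\<close>.\<close>

section \<open>Calculus of \<open>C\<^sup>k\<close> functions and \<open>C\<^sup>k\<close> limits\<close>

text \<open>Functions that agree near \<open>x\<close> have the same derivatives at \<open>x\<close>, and \<open>frechet_derivative\<close> is a choice among
these. The equality therefore includes points where neither function is differentiable, so that
iterated derivatives can be compared by a plain induction on their order.\<close>

lemma frechet_derivative_cong_open:
  assumes "open S" "x \<in> S" "\<And>y. y \<in> S \<Longrightarrow> f y = g y"
  shows "frechet_derivative f (at x) = frechet_derivative g (at x)"
proof -
  have "(f has_derivative D) (at x) \<longleftrightarrow> (g has_derivative D) (at x)" for D
    using has_derivative_transform_within_open[OF _ assms(1,2)] assms(3) by metis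
  then show ?thesis
    by (simp add: frechet_derivative_def)
qed

lemma differentiable_cong_open:
  assumes "open S" "x \<in> S" "\<And>y. y \<in> S \<Longrightarrow> f y = g y"
  shows "f differentiable (at x) \<longleftrightarrow> g differentiable (at x)"
  unfolding differentiable_def
  using has_derivative_transform_within_open[OF _ assms(1,2)] assms(3) by metis

lemma dir_deriv_cong_open:
  assumes "open S" "\<And>y. y \<in> S \<Longrightarrow> f y = g y" "x \<in> S"
  shows "dir_deriv vs f x = dir_deriv vs g x"
  using assms(3)
proof (induction vs arbitrary: x)
  case (Cons v vs)
  then show ?case
    using frechet_derivative_cong_open[OF assms(1), of x "dir_deriv vs f" "dir_deriv vs g"] by simp
qed (use assms(2) in simp)

text \<open>Splitting off the last vector puts the differentiation that is carried out first inside, and yields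
a recursion on the order in which \<open>C\<^sup>k\<close> is applied to the first derivative.\<close>

lemma dir_deriv_snoc:
  "dir_deriv (vs @ [v]) f = dir_deriv vs (\<lambda>x. frechet_derivative f (at x) v)"
  by (induction vs) auto

lemma all_short_lists_snoc:
  "(\<forall>vs. length vs < Suc k \<longrightarrow> P vs) \<longleftrightarrow> P [] \<and> (\<forall>v vs. length vs < k \<longrightarrow> P (vs @ [v]))"
  "(\<forall>vs. length vs \<le> Suc k \<longrightarrow> P vs) \<longleftrightarrow> P [] \<and> (\<forall>v vs. length vs \<le> k \<longrightarrow> P (vs @ [v]))"
proof -
  have "P vs" if "P []" "\<forall>v vs. length vs < k \<longrightarrow> P (vs @ [v])" "length vs < Suc k"
    for P :: "'a list \<Rightarrow> bool" and vs k
    using that by (cases vs rule: rev_cases) auto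
  then show "(\<forall>vs. length vs < Suc k \<longrightarrow> P vs) \<longleftrightarrow> P [] \<and> (\<forall>v vs. length vs < k \<longrightarrow> P (vs @ [v]))" for k
    by (auto 4 3)
  from this[of "Suc k"]
  show "(\<forall>vs. length vs \<le> Suc k \<longrightarrow> P vs) \<longleftrightarrow> P [] \<and> (\<forall>v vs. length vs \<le> k \<longrightarrow> P (vs @ [v]))"
    by (simp add: less_Suc_eq_le)
qed

lemma Ck_on_0: "Ck_on 0 S f \<longleftrightarrow> continuous_on S f"
  by (simp add: Ck_on_def)

text \<open>All stability properties of \<open>C\<^sup>k\<close> functions below are inductions on \<open>k\<close> along this recursion.\<close>

lemma Ck_on_Suc:
  "Ck_on (Suc k) S f \<longleftrightarrow>
     (\<forall>x\<in>S. f differentiable (at x)) \<and> (\<forall>v. Ck_on k S (\<lambda>x. frechet_derivative f (at x) v))"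
  (is "?L \<longleftrightarrow> ?R")
proof -
  have "?L \<longleftrightarrow> (\<forall>x\<in>S. f differentiable (at x)) \<and> continuous_on S f \<and>
      (\<forall>v. Ck_on k S (\<lambda>x. frechet_derivative f (at x) v))"
    unfolding Ck_on_def
    by (simp only: all_short_lists_snoc dir_deriv_snoc dir_deriv.simps all_conj_distrib conj_ac)
  moreover have "continuous_on S f" if "\<forall>x\<in>S. f differentiable (at x)"
    using that
    by (meson continuous_at_imp_continuous_on differentiable_imp_continuous_within)
  ultimately show ?thesis by blast
qed

lemma Ck_on_cong:
  assumes "open S" "\<And>x. x \<in> S \<Longrightarrow> f x = g x"
  shows "Ck_on k S f \<longleftrightarrow> Ck_on k S g"
proof -
  have d: "dir_deriv vs f x = dir_deriv vs g x" if "x \<in> S" for vs x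
    using dir_deriv_cong_open[OF assms that] .
  have "dir_deriv vs f differentiable (at x) \<longleftrightarrow> dir_deriv vs g differentiable (at x)"
    if "x \<in> S" for vs x
    using differentiable_cong_open[OF assms(1) that] d by blast
  moreover have "continuous_on S (dir_deriv vs f) \<longleftrightarrow> continuous_on S (dir_deriv vs g)" for vs
    using continuous_on_cong d by blast
  ultimately show ?thesis unfolding Ck_on_def by simp
qed

lemma Ck_on_mono: "Ck_on k S f \<Longrightarrow> m \<le> k \<Longrightarrow> Ck_on m S f"
  by (auto simp: Ck_on_def)

lemma Ck_on_subset: "Ck_on k S f \<Longrightarrow> S' \<subseteq> S \<Longrightarrow> Ck_on k S' f"
  unfolding Ck_on_def by (meson continuous_on_subset subsetD)

lemma Ck_on_local:
  assumes "\<And>x. x \<in> S \<Longrightarrow> \<exists>U. open U \<and> x \<in> U \<and> Ck_on k U f"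
  shows "Ck_on k S f"
  unfolding Ck_on_def
proof (intro conjI allI impI ballI)
  fix vs :: "'a list" and x assume "length vs < k" "x \<in> S"
  then show "dir_deriv vs f differentiable at x"
    using assms[of x] unfolding Ck_on_def by blast
next
  fix vs :: "'a list" assume vs: "length vs \<le> k"
  show "continuous_on S (dir_deriv vs f)"
  proof (rule continuous_at_imp_continuous_on, rule ballI)
    fix x assume "x \<in> S"
    then obtain U where "open U" "x \<in> U" "Ck_on k U f" using assms by blast
    then show "isCont (dir_deriv vs f) x"
      using vs unfolding Ck_on_def by (meson continuous_on_eq_continuous_at)
  qed
qed

lemma Ck_on_const: "Ck_on k S (\<lambda>x. c)"
proof (induction k arbitrary: c)
  case (Suc k)
  show ?case
    unfolding Ck_on_Suc using Suc[of 0] by (simp add: frechet_derivative_const)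
qed (simp add: Ck_on_0)

text \<open>The form in which the recursion is applied when a differentiation rule supplies a formula for the
derivative.\<close>

lemma Ck_on_SucI:
  assumes S: "open S" and D: "\<And>x. x \<in> S \<Longrightarrow> (f has_derivative D x) (at x)"
    and Ck: "\<And>v. Ck_on k S (\<lambda>x. D x v)"
  shows "Ck_on (Suc k) S f"
proof -
  have eq: "D x v = frechet_derivative f (at x) v" if "x \<in> S" for x v
    using frechet_derivative_at[OF D[OF that]] by simp
  have "Ck_on k S (\<lambda>x. frechet_derivative f (at x) v)" for v
    using Ck[of v] eq by (subst (asm) Ck_on_cong[OF S]) auto
  then show ?thesis
    using D by (auto simp: Ck_on_Suc differentiable_def)
qed

lemma Ck_on_SucD:
  assumes "Ck_on (Suc k) S f"
  shows "x \<in> S \<Longrightarrow> (f has_derivative frechet_derivative f (at x)) (at x)"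
    and "Ck_on k S (\<lambda>x. frechet_derivative f (at x) v)"
    and "Ck_on k S f"
  using assms Ck_on_mono[OF assms, of k] by (auto simp: Ck_on_Suc frechet_derivative_works)

lemma Ck_on_bounded_linear:
  assumes L: "bounded_linear L" and S: "open S" and f: "Ck_on k S f"
  shows "Ck_on k S (\<lambda>x. L (f x))"
  using f
proof (induction k arbitrary: f)
  case 0
  then show ?case using bounded_linear.continuous_on[OF L] by (auto simp: Ck_on_0)
next
  case (Suc k)
  then have df: "x \<in> S \<Longrightarrow> (f has_derivative frechet_derivative f (at x)) (at x)" for x
    by (simp add: Ck_on_Suc frechet_derivative_works)
  have D: "((\<lambda>x. L (f x)) has_derivative (\<lambda>v. L (frechet_derivative f (at x) v))) (at x)"
    if "x \<in> S" for x
    using bounded_linear.has_derivative[OF L df[OF that]] .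
  have "Ck_on k S (\<lambda>x. L (frechet_derivative f (at x) v))" for v
    using Suc by (auto simp: Ck_on_Suc)
  with D show ?case by (rule Ck_on_SucI[OF S])
qed

lemma Ck_on_add:
  assumes S: "open S" and f: "Ck_on k S f" "Ck_on k S g"
  shows "Ck_on k S (\<lambda>x. f x + g x)"
  using f
proof (induction k arbitrary: f g)
  case 0
  then show ?case by (auto simp: Ck_on_0 intro: continuous_on_add)
next
  case (Suc k)
  have D: "((\<lambda>x. f x + g x) has_derivative
      (\<lambda>v. frechet_derivative f (at x) v + frechet_derivative g (at x) v)) (at x)"
    if "x \<in> S" for x
    using that Suc.prems by (intro has_derivative_add) (auto simp: Ck_on_Suc frechet_derivative_works)
  have "Ck_on k S (\<lambda>x. frechet_derivative f (at x) v + frechet_derivative g (at x) v)" for v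
    using Suc by (auto simp: Ck_on_Suc)
  with D show ?case by (rule Ck_on_SucI[OF S])
qed

lemma Ck_on_sum:
  assumes "open S" "finite I" "\<And>i. i \<in> I \<Longrightarrow> Ck_on k S (f i)"
  shows "Ck_on k S (\<lambda>x. \<Sum>i\<in>I. f i x)"
  using assms(2,3)
  by (induction I rule: finite_induct) (simp_all add: Ck_on_const Ck_on_add[OF assms(1)])

lemma Ck_on_scaleR:
  assumes S: "open S" and f: "Ck_on k S a" "Ck_on k S f"
  shows "Ck_on k S (\<lambda>x. a x *\<^sub>R f x)"
  using f
proof (induction k arbitrary: a f)
  case 0
  then show ?case by (auto simp: Ck_on_0 intro: continuous_on_scaleR)
next
  case (Suc k)
  have D: "((\<lambda>x. a x *\<^sub>R f x) has_derivative
      (\<lambda>v. a x *\<^sub>R frechet_derivative f (at x) v + frechet_derivative a (at x) v *\<^sub>R f x)) (at x)"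
    if "x \<in> S" for x
    using that Suc.prems by (intro has_derivative_scaleR) (auto simp: Ck_on_Suc frechet_derivative_works)
  have "Ck_on k S (\<lambda>x. a x *\<^sub>R frechet_derivative f (at x) v + frechet_derivative a (at x) v *\<^sub>R f x)" for v
      by (intro Ck_on_add[OF S] Suc.IH Ck_on_SucD[OF Suc.prems(1)] Ck_on_SucD[OF Suc.prems(2)])
  with D show ?case by (rule Ck_on_SucI[OF S])
qed

text \<open>Derivatives take values in linear maps. The expansion in a basis replaces the evaluation of a linear
map by sums of scalar multiples, to which the product rule applies.\<close>

lemma linear_euclidean_expansion:
  fixes L :: "'e::euclidean_space \<Rightarrow> 'f::real_vector"
  assumes "linear L"
  shows "L v = (\<Sum>b\<in>Basis. (v \<bullet> b) *\<^sub>R L b)"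
proof -
  have "L v = L (\<Sum>b\<in>Basis. (v \<bullet> b) *\<^sub>R b)" by (simp add: euclidean_representation)
  also have "\<dots> = (\<Sum>b\<in>Basis. (v \<bullet> b) *\<^sub>R L b)"
    by (simp add: linear_sum[OF assms] linear_scale[OF assms])
  finally show ?thesis .
qed

lemma linear_frechet_derivative:
  "f differentiable (at x) \<Longrightarrow> linear (frechet_derivative f (at x))"
  by (rule has_derivative_linear[OF frechet_derivative_works[THEN iffD1]])

lemma has_derivative_comp_expansion:
  fixes g :: "'e::euclidean_space \<Rightarrow> 'f::euclidean_space" and f :: "'f \<Rightarrow> 'h::real_normed_vector"
  assumes "(g has_derivative g') (at x)"
    and "(f has_derivative frechet_derivative f (at (g x))) (at (g x))"
  shows "((f \<circ> g) has_derivative (\<lambda>v. \<Sum>b\<in>Basis. (g' v \<bullet> b) *\<^sub>R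
        ((\<lambda>y. frechet_derivative f (at y) b) \<circ> g) x)) (at x)"
proof -
  have "frechet_derivative f (at (g x)) \<circ> g' = (\<lambda>v. \<Sum>b\<in>Basis. (g' v \<bullet> b) *\<^sub>R
        ((\<lambda>y. frechet_derivative f (at y) b) \<circ> g) x)"
    unfolding o_def by (rule ext, rule linear_euclidean_expansion[OF has_derivative_linear[OF assms(2)]])
  with diff_chain_at[OF assms] show ?thesis by metis
qed

text \<open>By the chain rule, the derivative of \<open>f \<circ> g\<close> in direction \<open>v\<close> has the coefficients \<open>Dg(x) v \<bullet> b\<close>, which are
\<open>C\<^sup>k\<close>, in front of the vectors \<open>Df(g x) b\<close>, which are \<open>C\<^sup>k\<close> by the induction hypothesis.\<close>

lemma Ck_on_compose:
  fixes g :: "'e::euclidean_space \<Rightarrow> 'f::euclidean_space" and f :: "'f \<Rightarrow> 'h::real_normed_vector"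
  assumes S: "open S" and "Ck_on k W f" "Ck_on k S g" and sub: "g ` S \<subseteq> W"
  shows "Ck_on k S (f \<circ> g)"
  using assms(2,3)
proof (induction k arbitrary: f)
  case 0
  then show ?case
    unfolding Ck_on_0 by (meson continuous_on_compose continuous_on_subset sub)
next
  case (Suc k)
  note g = Ck_on_SucD[OF Suc.prems(2)] and f = Ck_on_SucD[OF Suc.prems(1)]
  have D: "((f \<circ> g) has_derivative (\<lambda>v. \<Sum>b\<in>Basis. (frechet_derivative g (at x) v \<bullet> b) *\<^sub>R
        ((\<lambda>y. frechet_derivative f (at y) b) \<circ> g) x)) (at x)" if "x \<in> S" for x
    using that sub by (intro has_derivative_comp_expansion g(1) f(1)) auto
  have "Ck_on k S (\<lambda>x. \<Sum>b\<in>Basis. (frechet_derivative g (at x) v \<bullet> b) *\<^sub>R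
        ((\<lambda>y. frechet_derivative f (at y) b) \<circ> g) x)" for v
    by (intro Ck_on_sum[OF S] finite_Basis Ck_on_scaleR[OF S]
        Ck_on_bounded_linear[OF bounded_linear_inner_left S] Suc.IH f g)
  with D show ?case by (rule Ck_on_SucI[OF S])
qed

text \<open>This evaluation costs one derivative of \<open>f\<close>. It is the reason why a diffeomorphism that acts on \<open>C\<^sup>r\<close>
vector fields has to be of class \<open>C\<^bsup>r+1\<^esup>\<close>.\<close>

lemma Ck_on_derivative_apply:
  fixes f :: "'e::euclidean_space \<Rightarrow> 'f::real_normed_vector"
  assumes S: "open S" and f: "Ck_on (Suc k) S f" and Y: "Ck_on k S Y"
  shows "Ck_on k S (\<lambda>x. frechet_derivative f (at x) (Y x))"
proof -
  have "Ck_on k S (\<lambda>x. \<Sum>b\<in>Basis. (Y x \<bullet> b) *\<^sub>R frechet_derivative f (at x) b)"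
    using f Y
    by (intro Ck_on_sum[OF S] finite_Basis Ck_on_scaleR[OF S]
        Ck_on_bounded_linear[OF bounded_linear_inner_left S]) (auto simp: Ck_on_Suc)
  moreover have "frechet_derivative f (at x) (Y x) =
      (\<Sum>b\<in>Basis. (Y x \<bullet> b) *\<^sub>R frechet_derivative f (at x) b)" if "x \<in> S" for x
    using f that by (intro linear_euclidean_expansion linear_frechet_derivative) (auto simp: Ck_on_Suc)
  ultimately show ?thesis by (subst Ck_on_cong[OF S])
qed

text \<open>Uniform convergence on compact sets of all derivatives of order at most \<open>k\<close>: this is the \<open>C\<^sup>k\<close> topology
as seen in one chart.\<close>

definition Ck_lim ::
  "nat \<Rightarrow> 'e::euclidean_space set \<Rightarrow> ('b \<Rightarrow> 'e \<Rightarrow> 'f::real_normed_vector) \<Rightarrow> ('e \<Rightarrow> 'f) \<Rightarrow> 'b filter \<Rightarrow> bool"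
  where "Ck_lim k S F f G \<longleftrightarrow>
    (\<forall>K. compact K \<and> K \<subseteq> S \<longrightarrow> (\<forall>vs. length vs \<le> k \<longrightarrow>
       uniform_limit K (\<lambda>s. dir_deriv vs (F s)) (dir_deriv vs f) G))"

lemma Ck_lim_0:
  "Ck_lim 0 S F f G \<longleftrightarrow> (\<forall>K. compact K \<and> K \<subseteq> S \<longrightarrow> uniform_limit K F f G)"
  by (simp add: Ck_lim_def)

lemma Ck_lim_Suc:
  "Ck_lim (Suc k) S F f G \<longleftrightarrow> Ck_lim 0 S F f G \<and>
     (\<forall>v. Ck_lim k S (\<lambda>s x. frechet_derivative (F s) (at x) v) (\<lambda>x. frechet_derivative f (at x) v) G)"
proof -
  have "(\<forall>K. C K \<longrightarrow> P K \<and> (\<forall>v vs. l vs \<longrightarrow> Q K v vs)) \<longleftrightarrow>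
      (\<forall>K. C K \<longrightarrow> P K) \<and> (\<forall>v K. C K \<longrightarrow> (\<forall>vs. l vs \<longrightarrow> Q K v vs))"
    for C P :: "'a set \<Rightarrow> bool" and l :: "'a list \<Rightarrow> bool" and Q :: "'a set \<Rightarrow> 'a \<Rightarrow> 'a list \<Rightarrow> bool"
    by blast
  then show ?thesis
    unfolding Ck_lim_0 unfolding Ck_lim_def all_short_lists_snoc dir_deriv_snoc dir_deriv.simps .
qed

lemma Ck_lim_cong:
  assumes S: "open S" and F: "\<forall>\<^sub>F s in G. \<forall>x\<in>S. F s x = F' s x" and f: "\<And>x. x \<in> S \<Longrightarrow> f x = f' x"
  shows "Ck_lim k S F f G \<longleftrightarrow> Ck_lim k S F' f' G"
proof -
  have "uniform_limit K (\<lambda>s. dir_deriv vs (F s)) (dir_deriv vs f) G \<longleftrightarrow>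
    uniform_limit K (\<lambda>s. dir_deriv vs (F' s)) (dir_deriv vs f') G" if "K \<subseteq> S" for K vs
  proof (rule uniform_limit_cong)
    show "\<forall>\<^sub>F s in G. \<forall>x\<in>K. dir_deriv vs (F s) x = dir_deriv vs (F' s) x"
      using F by eventually_elim (use that dir_deriv_cong_open[OF S] in blast)
    show "x \<in> K \<Longrightarrow> dir_deriv vs f x = dir_deriv vs f' x" for x
      using that dir_deriv_cong_open[OF S] f by blast
  qed
  then show ?thesis unfolding Ck_lim_def by auto
qed

lemma Ck_lim_mono: "Ck_lim k S F f G \<Longrightarrow> m \<le> k \<Longrightarrow> Ck_lim m S F f G"
  unfolding Ck_lim_def by (meson order_trans)

lemma Ck_lim_subset: "Ck_lim k S F f G \<Longrightarrow> S' \<subseteq> S \<Longrightarrow> Ck_lim k S' F f G"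
  unfolding Ck_lim_def by (meson order_trans)

text \<open>A compact set is covered by finitely many balls whose closures lie in the neighbourhoods where
convergence is known.\<close>

lemma Ck_lim_local:
  assumes loc: "\<And>x. x \<in> S \<Longrightarrow> \<exists>U. open U \<and> x \<in> U \<and> Ck_lim k U F f G"
  shows "Ck_lim k S F f G"
  unfolding Ck_lim_def
proof (intro allI impI)
  fix K vs assume K: "compact K \<and> K \<subseteq> S" and vs: "length (vs::'a list) \<le> k"
  define lim where "lim J \<longleftrightarrow> uniform_limit J (\<lambda>s. dir_deriv vs (F s)) (dir_deriv vs f) G" for J
  have "\<exists>e. e > 0 \<and> lim (cball x e)" if x: "x \<in> K" for x
  proof -
    obtain U where U: "open U" "x \<in> U" "Ck_lim k U F f G" using loc[of x] x K by auto
    then obtain e where "e > 0" "cball x e \<subseteq> U" using open_contains_cball_eq by blast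
    moreover have "lim (cball x e)" if "cball x e \<subseteq> U"
      using U(3) vs that unfolding Ck_lim_def lim_def by simp
    ultimately show ?thesis by blast
  qed
  then obtain e where e: "\<And>x. x \<in> K \<Longrightarrow> e x > 0" "\<And>x. x \<in> K \<Longrightarrow> lim (cball x (e x))"
    by metis
  obtain D where D: "D \<subseteq> K" "finite D" "K \<subseteq> (\<Union>x\<in>D. ball x (e x))"
  proof (rule compactE_image[of K K "\<lambda>x. ball x (e x)"])
    show "K \<subseteq> (\<Union>x\<in>K. ball x (e x))" using e(1) by (meson UN_I centre_in_ball subsetI)
  qed (use K in auto)
  have "lim (\<Union>x\<in>D. cball x (e x))"
    unfolding lim_def
  proof (rule uniform_limit_on_UNION[OF D(2)])
    fix x assume "x \<in> D"
    then have "lim (cball x (e x))" using D(1) e(2) by blast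
    then show "uniform_limit (cball x (e x)) (\<lambda>s. dir_deriv vs (F s)) (dir_deriv vs f) G"
      unfolding lim_def .
  qed
  moreover have "(\<Union>x\<in>D. ball x (e x)) \<subseteq> (\<Union>x\<in>D. cball x (e x))"
    by (intro UN_mono ball_subset_cball order_refl)
  with D(3) have "K \<subseteq> (\<Union>x\<in>D. cball x (e x))"
    by (rule order_trans)
  ultimately show "uniform_limit K (\<lambda>s. dir_deriv vs (F s)) (dir_deriv vs f) G"
    unfolding lim_def by (rule uniform_limit_on_subset)
qed

lemma Ck_lim_const: "Ck_lim k S (\<lambda>s. f) f G"
  by (auto simp: Ck_lim_def uniform_limit_iff)

lemma Ck_lim_SucI:
  assumes S: "open S" and lim0: "Ck_lim 0 S F f G"
    and DF: "\<forall>\<^sub>F s in G. \<forall>x\<in>S. (F s has_derivative F' s x) (at x)"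
    and Df: "\<And>x. x \<in> S \<Longrightarrow> (f has_derivative f' x) (at x)"
    and lim: "\<And>v. Ck_lim k S (\<lambda>s x. F' s x v) (\<lambda>x. f' x v) G"
  shows "Ck_lim (Suc k) S F f G"
proof -
  have "\<forall>\<^sub>F s in G. \<forall>x\<in>S. F' s x v = frechet_derivative (F s) (at x) v" for v
    using DF by eventually_elim (metis frechet_derivative_at)
  moreover have "f' x v = frechet_derivative f (at x) v" if "x \<in> S" for x v
    using frechet_derivative_at[OF Df[OF that]] by simp
  ultimately have "Ck_lim k S (\<lambda>s x. frechet_derivative (F s) (at x) v)
      (\<lambda>x. frechet_derivative f (at x) v) G" for v
    using lim[of v] by (subst (asm) Ck_lim_cong[OF S])
  with lim0 show ?thesis by (simp add: Ck_lim_Suc)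
qed

lemma Ck_lim_SucD:
  assumes "Ck_lim (Suc k) S F f G"
  shows "Ck_lim k S (\<lambda>s x. frechet_derivative (F s) (at x) v) (\<lambda>x. frechet_derivative f (at x) v) G"
    and "Ck_lim k S F f G" and "Ck_lim 0 S F f G"
  using assms Ck_lim_mono[OF assms] by (auto simp: Ck_lim_Suc)

lemma eventually_Ck_on_SucD:
  assumes "\<forall>\<^sub>F s in G. Ck_on (Suc k) S (F s)"
  shows "\<forall>\<^sub>F s in G. \<forall>x\<in>S. (F s has_derivative frechet_derivative (F s) (at x)) (at x)"
    and "\<forall>\<^sub>F s in G. Ck_on k S (\<lambda>x. frechet_derivative (F s) (at x) v)"
    and "\<forall>\<^sub>F s in G. Ck_on k S (F s)"
  using assms by (auto elim!: eventually_mono dest: Ck_on_SucD)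

lemma Ck_lim_bounded_linear:
  assumes L: "bounded_linear L" and S: "open S"
    and "Ck_lim k S F f G" "\<forall>\<^sub>F s in G. Ck_on k S (F s)" "Ck_on k S f"
  shows "Ck_lim k S (\<lambda>s x. L (F s x)) (\<lambda>x. L (f x)) G"
  using assms(3-5)
proof (induction k arbitrary: F f)
  case 0
  then show ?case unfolding Ck_lim_0 using bounded_linear.uniform_limit[OF L] by blast
next
  case (Suc k)
  note lim = Ck_lim_SucD[OF Suc.prems(1)]
    and ev = eventually_Ck_on_SucD[OF Suc.prems(2)] and f = Ck_on_SucD[OF Suc.prems(3)]
  show ?case
  proof (rule Ck_lim_SucI[OF S])
    show "Ck_lim 0 S (\<lambda>s x. L (F s x)) (\<lambda>x. L (f x)) G"
      using lim(3) bounded_linear.uniform_limit[OF L] unfolding Ck_lim_0 by blast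
    show "\<forall>\<^sub>F s in G. \<forall>x\<in>S. ((\<lambda>x. L (F s x)) has_derivative
        (\<lambda>v. L (frechet_derivative (F s) (at x) v))) (at x)"
      using ev(1) by eventually_elim (auto intro: bounded_linear.has_derivative[OF L])
    show "((\<lambda>x. L (f x)) has_derivative (\<lambda>v. L (frechet_derivative f (at x) v))) (at x)"
      if "x \<in> S" for x
      by (rule bounded_linear.has_derivative[OF L f(1)[OF that]])
    show "Ck_lim k S (\<lambda>s x. L (frechet_derivative (F s) (at x) v))
      (\<lambda>x. L (frechet_derivative f (at x) v)) G" for v
      by (rule Suc.IH[OF lim(1) ev(2) f(2)])
  qed
qed

lemma Ck_lim_add:
  assumes S: "open S"
    and "Ck_lim k S F f G" "\<forall>\<^sub>F s in G. Ck_on k S (F s)" "Ck_on k S f"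
    and "Ck_lim k S H h G" "\<forall>\<^sub>F s in G. Ck_on k S (H s)" "Ck_on k S h"
  shows "Ck_lim k S (\<lambda>s x. F s x + H s x) (\<lambda>x. f x + h x) G"
  using assms(2-7)
proof (induction k arbitrary: F f H h)
  case 0
  then show ?case unfolding Ck_lim_0 by (auto intro: uniform_limit_add)
next
  case (Suc k)
  note lim = Ck_lim_SucD[OF Suc.prems(1)] Ck_lim_SucD[OF Suc.prems(4)]
    and evF = eventually_Ck_on_SucD[OF Suc.prems(2)] and f = Ck_on_SucD[OF Suc.prems(3)]
    and evH = eventually_Ck_on_SucD[OF Suc.prems(5)] and h = Ck_on_SucD[OF Suc.prems(6)]
  show ?case
  proof (rule Ck_lim_SucI[OF S])
    show "Ck_lim 0 S (\<lambda>s x. F s x + H s x) (\<lambda>x. f x + h x) G"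
      using lim(3,6) unfolding Ck_lim_0 by (auto intro: uniform_limit_add)
    show "\<forall>\<^sub>F s in G. \<forall>x\<in>S. ((\<lambda>x. F s x + H s x) has_derivative
        (\<lambda>v. frechet_derivative (F s) (at x) v + frechet_derivative (H s) (at x) v)) (at x)"
      using evF(1) evH(1) by eventually_elim (auto intro: has_derivative_add)
    show "((\<lambda>x. f x + h x) has_derivative
        (\<lambda>v. frechet_derivative f (at x) v + frechet_derivative h (at x) v)) (at x)"
      if "x \<in> S" for x
      by (rule has_derivative_add[OF f(1)[OF that] h(1)[OF that]])
    show "Ck_lim k S (\<lambda>s x. frechet_derivative (F s) (at x) v + frechet_derivative (H s) (at x) v)
      (\<lambda>x. frechet_derivative f (at x) v + frechet_derivative h (at x) v) G" for v
      by (rule Suc.IH[OF lim(1) evF(2) f(2) lim(4) evH(2) h(2)])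
  qed
qed

lemma Ck_lim_sum:
  assumes S: "open S" and "finite I" 
    and "\<And>i. i \<in> I \<Longrightarrow> Ck_lim k S (F i) (f i) G" "\<And>i. i \<in> I \<Longrightarrow> \<forall>\<^sub>F s in G. Ck_on k S (F i s)"
      "\<And>i. i \<in> I \<Longrightarrow> Ck_on k S (f i)"
  shows "Ck_lim k S (\<lambda>s x. \<Sum>i\<in>I. F i s x) (\<lambda>x. \<Sum>i\<in>I. f i x) G"
  using assms(2-5)
proof (induction I rule: finite_induct)
  case empty
  then show ?case by (simp add: Ck_lim_const)
next
  case (insert i I)
  have "\<forall>\<^sub>F s in G. \<forall>i\<in>I. Ck_on k S (F i s)"
    using insert by (simp add: eventually_ball_finite_distrib)
  then have "\<forall>\<^sub>F s in G. Ck_on k S (\<lambda>x. \<Sum>i\<in>I. F i s x)"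
    by eventually_elim (use insert S in \<open>auto intro: Ck_on_sum\<close>)
  then show ?case
    using insert by (auto intro!: Ck_lim_add[OF S] Ck_on_sum[OF S])
qed

text \<open>Uniform limits may be multiplied because the limit functions are bounded on the compact set \<open>K\<close>.\<close>

lemma uniform_limit_scaleR_compact:
  fixes f :: "'e::topological_space \<Rightarrow> 'f::real_normed_vector"
  assumes K: "compact K" and a: "continuous_on K a" and f: "continuous_on K f"
    and lim: "uniform_limit K A a G" "uniform_limit K F f G"
  shows "uniform_limit K (\<lambda>s x. A s x *\<^sub>R F s x) (\<lambda>x. a x *\<^sub>R f x) G"
  by (rule bounded_bilinear.bounded_uniform_limit[OF bounded_bilinear_scaleR])
     (use lim compact_continuous_image[OF a K] compact_continuous_image[OF f K]
      in \<open>auto intro: compact_imp_bounded\<close>)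

lemma Ck_lim_scaleR:
  assumes S: "open S"
    and "Ck_lim k S A a G" "\<forall>\<^sub>F s in G. Ck_on k S (A s)" "Ck_on k S a"
    and "Ck_lim k S F f G" "\<forall>\<^sub>F s in G. Ck_on k S (F s)" "Ck_on k S f"
  shows "Ck_lim k S (\<lambda>s x. A s x *\<^sub>R F s x) (\<lambda>x. a x *\<^sub>R f x) G"
  using assms(2-7)
proof (induction k arbitrary: A a F f)
  case 0
  then show ?case
    unfolding Ck_lim_0 Ck_on_0 by (auto intro!: uniform_limit_scaleR_compact elim: continuous_on_subset)
next
  case (Suc k)
  note limA = Ck_lim_SucD[OF Suc.prems(1)] and limF = Ck_lim_SucD[OF Suc.prems(4)]
    and evA = eventually_Ck_on_SucD[OF Suc.prems(2)] and a = Ck_on_SucD[OF Suc.prems(3)]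
    and evF = eventually_Ck_on_SucD[OF Suc.prems(5)] and f = Ck_on_SucD[OF Suc.prems(6)]
  show ?case
  proof (rule Ck_lim_SucI[OF S])
    have "continuous_on S a" "continuous_on S f"
      using Suc.prems(3,6) by (auto simp: Ck_on_0[symmetric] elim: Ck_on_mono)
    then show "Ck_lim 0 S (\<lambda>s x. A s x *\<^sub>R F s x) (\<lambda>x. a x *\<^sub>R f x) G"
      using limA(3) limF(3) unfolding Ck_lim_0
      by (auto intro!: uniform_limit_scaleR_compact elim: continuous_on_subset)
    show "\<forall>\<^sub>F s in G. \<forall>x\<in>S. ((\<lambda>x. A s x *\<^sub>R F s x) has_derivative
        (\<lambda>v. A s x *\<^sub>R frechet_derivative (F s) (at x) v
             + frechet_derivative (A s) (at x) v *\<^sub>R F s x)) (at x)"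
      using evA(1) evF(1) by eventually_elim (auto intro: has_derivative_scaleR)
    show "((\<lambda>x. a x *\<^sub>R f x) has_derivative
        (\<lambda>v. a x *\<^sub>R frechet_derivative f (at x) v + frechet_derivative a (at x) v *\<^sub>R f x)) (at x)"
      if "x \<in> S" for x
      by (rule has_derivative_scaleR[OF a(1)[OF that] f(1)[OF that]])
    have ev1: "\<forall>\<^sub>F s in G. Ck_on k S (\<lambda>x. A s x *\<^sub>R frechet_derivative (F s) (at x) v)" for v
      using evA(3) evF(2) by eventually_elim (rule Ck_on_scaleR[OF S])
    have ev2: "\<forall>\<^sub>F s in G. Ck_on k S (\<lambda>x. frechet_derivative (A s) (at x) v *\<^sub>R F s x)" for v
      using evA(2) evF(3) by eventually_elim (rule Ck_on_scaleR[OF S])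
    show "Ck_lim k S (\<lambda>s x. A s x *\<^sub>R frechet_derivative (F s) (at x) v
             + frechet_derivative (A s) (at x) v *\<^sub>R F s x)
        (\<lambda>x. a x *\<^sub>R frechet_derivative f (at x) v + frechet_derivative a (at x) v *\<^sub>R f x) G" for v
      by (intro Ck_lim_add[OF S] Suc.IH Ck_on_scaleR[OF S] ev1 ev2 limA limF evA evF a f)
  qed
qed

lemma Ck_lim_compose:
  fixes g :: "'e::euclidean_space \<Rightarrow> 'f::euclidean_space" and f :: "'f \<Rightarrow> 'h::real_normed_vector"
  assumes S: "open S" and "Ck_lim k W F f G" "\<forall>\<^sub>F s in G. Ck_on k W (F s)" "Ck_on k W f" "Ck_on k S g"
    and sub: "g ` S \<subseteq> W"
  shows "Ck_lim k S (\<lambda>s. F s \<circ> g) (f \<circ> g) G"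
  using assms(2-5)
proof (induction k arbitrary: F f)
  have zero: "Ck_lim 0 S (\<lambda>s. F s \<circ> g) (f \<circ> g) G"
    if lim: "Ck_lim 0 W F f G" and g: "Ck_on 0 S g" for F and f :: "'f \<Rightarrow> 'h"
    unfolding Ck_lim_0
  proof (intro allI impI)
    fix K assume K: "compact K \<and> K \<subseteq> S"
    have "compact (g ` K)"
      using K g by (auto simp: Ck_on_0 intro: compact_continuous_image continuous_on_subset)
    moreover have "g ` K \<subseteq> W" using K sub by auto
    ultimately have "uniform_limit (g ` K) F f G" using lim by (auto simp: Ck_lim_0)
    from uniform_limit_compose'[OF this, of g K] show "uniform_limit K (\<lambda>s. F s \<circ> g) (f \<circ> g) G"
      by (simp add: o_def)
  qed
  {
    case 0
    then show ?case using zero by blast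
  next
    case (Suc k)
    note lim = Ck_lim_SucD[OF Suc.prems(1)] and evF = eventually_Ck_on_SucD[OF Suc.prems(2)]
      and f = Ck_on_SucD[OF Suc.prems(3)] and g = Ck_on_SucD[OF Suc.prems(4)]
    show ?case
    proof (rule Ck_lim_SucI[OF S])
      show "Ck_lim 0 S (\<lambda>s. F s \<circ> g) (f \<circ> g) G"
        by (rule zero[OF lim(3) Ck_on_mono[OF Suc.prems(4)]]) simp
      show "\<forall>\<^sub>F s in G. \<forall>x\<in>S. ((F s \<circ> g) has_derivative
          (\<lambda>v. \<Sum>b\<in>Basis. (frechet_derivative g (at x) v \<bullet> b) *\<^sub>R
             ((\<lambda>y. frechet_derivative (F s) (at y) b) \<circ> g) x)) (at x)"
        using evF(1) by eventually_elim
          (intro ballI has_derivative_comp_expansion g(1), use sub in auto)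
      show "((f \<circ> g) has_derivative
          (\<lambda>v. \<Sum>b\<in>Basis. (frechet_derivative g (at x) v \<bullet> b) *\<^sub>R
             ((\<lambda>y. frechet_derivative f (at y) b) \<circ> g) x)) (at x)" if "x \<in> S" for x
        using sub that by (intro has_derivative_comp_expansion g(1) f(1)) auto
      have co: "Ck_on k S (\<lambda>x. frechet_derivative g (at x) v \<bullet> b)" for v b
        by (rule Ck_on_bounded_linear[OF bounded_linear_inner_left S g(2)])
      have F': "\<forall>\<^sub>F s in G. Ck_on k S ((\<lambda>y. frechet_derivative (F s) (at y) b) \<circ> g)" for b
        using evF(2) by eventually_elim (rule Ck_on_compose[OF S _ g(3) sub])
      have f': "Ck_on k S ((\<lambda>y. frechet_derivative f (at y) b) \<circ> g)" for b
        by (rule Ck_on_compose[OF S f(2) g(3) sub])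
      show "Ck_lim k S (\<lambda>s x. \<Sum>b\<in>Basis. (frechet_derivative g (at x) v \<bullet> b) *\<^sub>R
          ((\<lambda>y. frechet_derivative (F s) (at y) b) \<circ> g) x)
        (\<lambda>x. \<Sum>b\<in>Basis. (frechet_derivative g (at x) v \<bullet> b) *\<^sub>R
          ((\<lambda>y. frechet_derivative f (at y) b) \<circ> g) x) G" for v
      proof (rule Ck_lim_sum[OF S finite_Basis])
        fix b :: 'f assume "b \<in> Basis"
        show "Ck_lim k S (\<lambda>s x. (frechet_derivative g (at x) v \<bullet> b) *\<^sub>R
            ((\<lambda>y. frechet_derivative (F s) (at y) b) \<circ> g) x)
          (\<lambda>x. (frechet_derivative g (at x) v \<bullet> b) *\<^sub>R ((\<lambda>y. frechet_derivative f (at y) b) \<circ> g) x) G"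
          by (rule Ck_lim_scaleR[OF S Ck_lim_const _ co Suc.IH[OF lim(1) evF(2) f(2) g(3)] F' f'])
             (simp add: co)
        show "\<forall>\<^sub>F s in G. Ck_on k S (\<lambda>x. (frechet_derivative g (at x) v \<bullet> b) *\<^sub>R
            ((\<lambda>y. frechet_derivative (F s) (at y) b) \<circ> g) x)"
          using F' by eventually_elim (rule Ck_on_scaleR[OF S co])
        show "Ck_on k S (\<lambda>x. (frechet_derivative g (at x) v \<bullet> b) *\<^sub>R
            ((\<lambda>y. frechet_derivative f (at y) b) \<circ> g) x)"
          by (rule Ck_on_scaleR[OF S co f'])
      qed
    qed
  }
qed

text \<open>The counterpart of \<open>Ck_on_derivative_apply\<close> for limits: for fixed \<open>f\<close>, the operator
\<open>Y \<mapsto> (x \<mapsto> Df(x) (Y x))\<close> is continuous in the \<open>C\<^sup>k\<close> topology.\<close>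

lemma Ck_lim_derivative_apply:
  fixes f :: "'e::euclidean_space \<Rightarrow> 'f::real_normed_vector"
  assumes S: "open S" and f: "Ck_on (Suc k) S f"
    and Y: "Ck_lim k S F Y G" "\<forall>\<^sub>F s in G. Ck_on k S (F s)" "Ck_on k S Y"
  shows "Ck_lim k S (\<lambda>s x. frechet_derivative f (at x) (F s x))
     (\<lambda>x. frechet_derivative f (at x) (Y x)) G"
proof -
  have ex: "frechet_derivative f (at x) (v::'e) =
      (\<Sum>b\<in>Basis. (v \<bullet> b) *\<^sub>R frechet_derivative f (at x) b)" if "x \<in> S" for x v
    using f that by (intro linear_euclidean_expansion linear_frechet_derivative) (auto simp: Ck_on_Suc)
  have co: "Ck_on k S (\<lambda>x. H x \<bullet> b)" if "Ck_on k S H" for H :: "'e \<Rightarrow> 'e" and b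
    by (rule Ck_on_bounded_linear[OF bounded_linear_inner_left S that])
  have D: "Ck_on k S (\<lambda>x. frechet_derivative f (at x) b)" for b
    using f by (simp add: Ck_on_Suc)
  have coF: "\<forall>\<^sub>F s in G. Ck_on k S (\<lambda>x. F s x \<bullet> b)" for b
    using Y(2) by eventually_elim (rule co)
  have "Ck_lim k S (\<lambda>s x. \<Sum>b\<in>Basis. (F s x \<bullet> b) *\<^sub>R frechet_derivative f (at x) b)
     (\<lambda>x. \<Sum>b\<in>Basis. (Y x \<bullet> b) *\<^sub>R frechet_derivative f (at x) b) G"
  proof (rule Ck_lim_sum[OF S finite_Basis])
    fix b :: 'e assume "b \<in> Basis"
    show "Ck_lim k S (\<lambda>s x. (F s x \<bullet> b) *\<^sub>R frechet_derivative f (at x) b)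
        (\<lambda>x. (Y x \<bullet> b) *\<^sub>R frechet_derivative f (at x) b) G"
      by (rule Ck_lim_scaleR[OF S Ck_lim_bounded_linear[OF bounded_linear_inner_left S Y] coF
            co[OF Y(3)] Ck_lim_const _ D]) (simp add: D)
    show "\<forall>\<^sub>F s in G. Ck_on k S (\<lambda>x. (F s x \<bullet> b) *\<^sub>R frechet_derivative f (at x) b)"
      using coF by eventually_elim (rule Ck_on_scaleR[OF S _ D])
    show "Ck_on k S (\<lambda>x. (Y x \<bullet> b) *\<^sub>R frechet_derivative f (at x) b)"
      by (rule Ck_on_scaleR[OF S co[OF Y(3)] D])
  qed
  moreover have "\<forall>\<^sub>F s in G. \<forall>x\<in>S. frechet_derivative f (at x) (F s x)
      = (\<Sum>b\<in>Basis. (F s x \<bullet> b) *\<^sub>R frechet_derivative f (at x) b)"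
    using ex by simp
  ultimately show ?thesis
    using ex by (subst Ck_lim_cong[OF S])
qed

section \<open>Charts and tangent maps\<close>

definition coord_expr ::
  "('a \<Rightarrow> 'a) \<Rightarrow> ('a, 'e) chart \<Rightarrow> ('a, 'e) chart \<Rightarrow> 'e \<Rightarrow> 'e" where
  "coord_expr f c c' = cmap c' \<circ> f \<circ> cinv c"

definition coord_dom ::
  "('a \<Rightarrow> 'a) \<Rightarrow> ('a, 'e) chart \<Rightarrow> ('a, 'e) chart \<Rightarrow> 'e set" where
  "coord_dom f c c' = cmap c ` {x \<in> cdom c. f x \<in> cdom c'}"

abbreviation coord_deriv ::
  "('a \<Rightarrow> 'a) \<Rightarrow> ('a, 'e::euclidean_space) chart \<Rightarrow> ('a, 'e) chart \<Rightarrow> 'a \<Rightarrow> 'e \<Rightarrow> 'e" where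
  "coord_deriv f c c' x \<equiv> frechet_derivative (coord_expr f c c') (at (cmap c x))"

lemma coord_expr_id: "coord_expr id c c' = cmap c' \<circ> cinv c"
  by (simp add: coord_expr_def)

lemma charts_at_iff: "c \<in> charts_at A x \<longleftrightarrow> c \<in> A \<and> x \<in> cdom c"
  by (simp add: charts_at_def)

text \<open>Charts are pairs, but are always treated as single objects here.\<close>

declare split_paired_All [simp del] split_paired_Ex [simp del]

locale manifold_atlas =
  fixes T :: "'a topology" and A :: "('a, 'e::euclidean_space) chart set"
  assumes smooth_manifold: "smooth_manifold T A"
begin

lemma charts_cover: "(\<Union>c\<in>A. cdom c) = topspace T"
  and openin_cdom: "c \<in> A \<Longrightarrow> openin T (cdom c)"
  and open_cimg: "c \<in> A \<Longrightarrow> open (cimg c)"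
  and homeomorphic_cmap:
    "c \<in> A \<Longrightarrow> homeomorphic_map (subtopology T (cdom c)) (top_of_set (cimg c)) (cmap c)"
  and transition_Ck: "c \<in> A \<Longrightarrow> c' \<in> A \<Longrightarrow>
      Ck_on m (cmap c ` (cdom c \<inter> cdom c')) (cmap c' \<circ> cinv c)"
  using smooth_manifold unfolding smooth_manifold_def by auto

lemma cdom_subset: "c \<in> A \<Longrightarrow> cdom c \<subseteq> topspace T"
  using charts_cover by blast

lemma topspace_cdom: "c \<in> A \<Longrightarrow> topspace (subtopology T (cdom c)) = cdom c"
  using cdom_subset by (simp add: inf.absorb2)

lemma inj_on_cmap: "c \<in> A \<Longrightarrow> inj_on (cmap c) (cdom c)"
  using homeomorphic_cmap topspace_cdom homeomorphic_imp_injective_map by metis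

lemma cinv_cmap: "c \<in> A \<Longrightarrow> x \<in> cdom c \<Longrightarrow> cinv c (cmap c x) = x"
  unfolding cinv_def by (simp add: inj_on_cmap inv_into_f_f)

lemma cmap_cinv: "p \<in> cimg c \<Longrightarrow> cmap c (cinv c p) = p"
  unfolding cinv_def by (rule f_inv_into_f)

lemma cinv_in_cdom: "p \<in> cimg c \<Longrightarrow> cinv c p \<in> cdom c"
  unfolding cinv_def by (rule inv_into_into)

lemma charts_at_ex: "x \<in> topspace T \<Longrightarrow> \<exists>c. c \<in> charts_at A x"
  using charts_cover by (auto simp: charts_at_iff)

lemma charts_at_imp_topspace: "c \<in> charts_at A x \<Longrightarrow> x \<in> topspace T"
  using charts_cover by (auto simp: charts_at_iff)

lemma open_cmap_image:
  assumes c: "c \<in> A" and U: "openin T U" "U \<subseteq> cdom c"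
  shows "open (cmap c ` U)"
proof -
  have "openin (subtopology T (cdom c)) U"
    using U by (auto simp: openin_subtopology)
  then have "openin (top_of_set (cimg c)) (cmap c ` U)"
    using homeomorphic_imp_open_map[OF homeomorphic_cmap[OF c]] by (auto simp: open_map_def)
  then show ?thesis
    using open_cimg[OF c] openin_open_trans by blast
qed

lemma continuous_map_cmap:
  "c \<in> A \<Longrightarrow> continuous_map (subtopology T (cdom c)) euclidean (cmap c)"
  using homeomorphic_cmap homeomorphic_imp_continuous_map continuous_map_into_fulltopology by blast

lemma continuous_map_cinv:
  assumes c: "c \<in> A" 
  shows "continuous_map (top_of_set (cimg c)) T (cinv c)"
proof -
  obtain g where g: "homeomorphic_maps (subtopology T (cdom c)) (top_of_set (cimg c)) (cmap c) g"
    using homeomorphic_cmap[OF c] homeomorphic_map_maps by blast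
  have "g p = cinv c p" if p: "p \<in> cimg c" for p
  proof -
    obtain x where "x \<in> cdom c" "p = cmap c x" using p by blast
    then show ?thesis
      using g topspace_cdom[OF c] by (simp add: homeomorphic_maps_def cinv_cmap[OF c])
  qed
  then have eq: "\<And>p. p \<in> topspace (top_of_set (cimg c)) \<Longrightarrow> g p = cinv c p"
    by simp
  have "continuous_map (top_of_set (cimg c)) (subtopology T (cdom c)) g"
    using g unfolding homeomorphic_maps_def by (elim conjE)
  from continuous_map_eq[OF continuous_map_into_fulltopology[OF this] eq]
  show ?thesis .
qed

lemma openin_preimage:
  assumes "continuous_map T T f" "openin T U" "openin T V"
  shows "openin T {x \<in> U. f x \<in> V}"
proof -
  have "{x \<in> U. f x \<in> V} = U \<inter> {x \<in> topspace T. f x \<in> V}"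
    using openin_subset[OF assms(2)] by auto
  then show ?thesis
    using openin_continuous_map_preimage[OF assms(1,3)] assms(2) by auto
qed

lemma Ck_mapD:
  assumes "Ck_map T A k f"
  shows "continuous_map T T f"
    and "x \<in> topspace T \<Longrightarrow> f x \<in> topspace T"
    and "c \<in> A \<Longrightarrow> c' \<in> A \<Longrightarrow> Ck_on k (coord_dom f c c') (coord_expr f c c')"
  using assms unfolding Ck_map_def coord_dom_def coord_expr_def
  by (auto simp: continuous_map_def)

lemma open_coord_dom:
  assumes "continuous_map T T f" "c \<in> A" "c' \<in> A"
  shows "open (coord_dom f c c')"
  unfolding coord_dom_def
  by (intro open_cmap_image openin_preimage assms openin_cdom) auto

lemma coord_expr_cmap:
  "c \<in> charts_at A x \<Longrightarrow> coord_expr f c c' (cmap c x) = cmap c' (f x)"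
  by (simp add: coord_expr_def charts_at_iff cinv_cmap)

lemma cmap_in_coord_dom:
  assumes "c \<in> charts_at A x" "c' \<in> charts_at A (f x)"
  shows "cmap c x \<in> coord_dom f c c'"
  using assms
  by (auto simp: coord_dom_def charts_at_iff)

lemma Ck_map_mono: "Ck_map T A k f \<Longrightarrow> m \<le> k \<Longrightarrow> Ck_map T A m f"
  unfolding Ck_map_def using Ck_on_mono by blast

lemma Ck_map_id: "Ck_map T A k id"
  unfolding Ck_map_def
  using transition_Ck by (auto simp: Int_def)

lemma coord_expr_compose:
  assumes "c \<in> A" "c' \<in> A" "p \<in> coord_dom f c c'"
  shows "coord_expr (g \<circ> f) c c'' p = (coord_expr g c' c'' \<circ> coord_expr f c c') p"
  using assms by (auto simp: coord_dom_def coord_expr_def cinv_cmap)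

lemma Ck_map_compose:
  assumes f: "Ck_map T A k f" and g: "Ck_map T A k g"
  shows "Ck_map T A k (g \<circ> f)"
proof -
  note contf = Ck_mapD(1)[OF f] and contg = Ck_mapD(1)[OF g]
  have cont: "continuous_map T T (g \<circ> f)"
    by (rule continuous_map_compose[OF contf contg])
  have "Ck_on k (coord_dom (g \<circ> f) c c'') (coord_expr (g \<circ> f) c c'')"
    if c: "c \<in> A" and c'': "c'' \<in> A" for c c''
  proof (rule Ck_on_local)
    fix p assume "p \<in> coord_dom (g \<circ> f) c c''"
    then obtain x where x: "x \<in> cdom c" "g (f x) \<in> cdom c''" "p = cmap c x"
      by (auto simp: coord_dom_def)
    then have "f x \<in> topspace T" using Ck_mapD(2)[OF f] cdom_subset[OF c] by blast
    then obtain c' where "c' \<in> charts_at A (f x)" using charts_at_ex by blast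
    then have c': "c' \<in> A" "f x \<in> cdom c'" by (simp_all add: charts_at_iff)
    let ?V = "{y \<in> cdom c'. g y \<in> cdom c''}"
    let ?U = "cmap c ` {x \<in> cdom c. f x \<in> ?V}"
    have V: "openin T ?V"
      by (intro openin_preimage[OF contg] openin_cdom c' c'')
    have U: "open ?U"
      by (rule open_cmap_image[OF c openin_preimage[OF contf openin_cdom[OF c] V]]) auto
    have sub: "?U \<subseteq> coord_dom f c c'" by (auto simp: coord_dom_def)
    have "Ck_on k ?U (coord_expr g c' c'' \<circ> coord_expr f c c')"
      by (rule Ck_on_compose[OF U Ck_mapD(3)[OF g c'(1) c''] Ck_on_subset[OF Ck_mapD(3)[OF f c c'(1)] sub]])
         (use c in \<open>auto simp: coord_dom_def coord_expr_def cinv_cmap\<close>)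
    moreover have "coord_expr (g \<circ> f) c c'' p = (coord_expr g c' c'' \<circ> coord_expr f c c') p"
      if "p \<in> ?U" for p
      using coord_expr_compose[OF c c'(1)] that sub by blast
    ultimately have "Ck_on k ?U (coord_expr (g \<circ> f) c c'')"
      by (subst Ck_on_cong[OF U])
    moreover have "p \<in> ?U" using x c' by auto
    ultimately show "\<exists>U. open U \<and> p \<in> U \<and> Ck_on k U (coord_expr (g \<circ> f) c c'')"
      using U by blast
  qed
  with cont show ?thesis
    unfolding Ck_map_def coord_dom_def coord_expr_def by auto
qed

lemma coord_expr_has_derivative:
  assumes f: "Ck_map T A 1 f" and c: "c \<in> charts_at A x" "c' \<in> charts_at A (f x)"
  shows "(coord_expr f c c' has_derivative coord_deriv f c c' x) (at (cmap c x))"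
proof -
  have "Ck_on (Suc 0) (coord_dom f c c') (coord_expr f c c')"
    using Ck_mapD(3)[OF f] c by (simp add: charts_at_iff)
  from Ck_on_SucD(1)[OF this] show ?thesis
    using cmap_in_coord_dom[of c x c' f, OF c] by blast
qed

lemma linear_coord_deriv:
  "Ck_map T A 1 f \<Longrightarrow> c \<in> charts_at A x \<Longrightarrow> c' \<in> charts_at A (f x) \<Longrightarrow>
    linear (coord_deriv f c c' x)"
  by (rule has_derivative_linear[OF coord_expr_has_derivative])

text \<open>With the identity as one of the two maps, this also describes the effect of a change of charts.\<close>

lemma coord_deriv_compose:
  assumes f: "Ck_map T A 1 f" and g: "Ck_map T A 1 g"
    and c: "c \<in> charts_at A x" "c' \<in> charts_at A (f x)" "c'' \<in> charts_at A (g (f x))"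
  shows "coord_deriv (g \<circ> f) c c'' x v = coord_deriv g c' c'' (f x) (coord_deriv f c c' x v)"
proof -
  have A: "c \<in> A" "c' \<in> A" using c by (auto simp: charts_at_iff)
  have U: "open (coord_dom f c c')" "cmap c x \<in> coord_dom f c c'"
    using open_coord_dom[OF Ck_mapD(1)[OF f] A] cmap_in_coord_dom[of c x c' f, OF c(1,2)] by auto
  have "coord_deriv (g \<circ> f) c c'' x
      = frechet_derivative (coord_expr g c' c'' \<circ> coord_expr f c c') (at (cmap c x))"
    by (rule frechet_derivative_cong_open[OF U coord_expr_compose[OF A]])
  also have "\<dots> = coord_deriv g c' c'' (f x) \<circ> coord_deriv f c c' x"
  proof (rule frechet_derivative_at[symmetric], rule diff_chain_at)
    show "(coord_expr f c c' has_derivative coord_deriv f c c' x) (at (cmap c x))"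
      by (rule coord_expr_has_derivative[OF f c(1,2)])
    show "(coord_expr g c' c'' has_derivative coord_deriv g c' c'' (f x))
        (at (coord_expr f c c' (cmap c x)))"
      using coord_expr_has_derivative[OF g c(2,3)] by (simp add: coord_expr_cmap[OF c(1)])
  qed
  finally show ?thesis by simp
qed

lemma coord_deriv_cong:
  assumes c: "c \<in> charts_at A x" and eq: "\<And>x. x \<in> topspace T \<Longrightarrow> f x = g x"
  shows "coord_deriv f c c' x = coord_deriv g c c' x"
proof (rule frechet_derivative_cong_open)
  show "open (cimg c)" "cmap c x \<in> cimg c" using c open_cimg by (auto simp: charts_at_iff)
  fix p assume "p \<in> cimg c"
  then show "coord_expr f c c' p = coord_expr g c c' p"
    using c eq[of "cinv c p"] cinv_in_cdom[of p c] cdom_subset[of c]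
    by (simp add: coord_expr_def charts_at_iff subset_eq)
qed

lemma coord_deriv_id:
  assumes c: "c \<in> charts_at A x" 
  shows "coord_deriv id c c x v = v"
proof -
  have "coord_deriv id c c x = frechet_derivative (\<lambda>p. p) (at (cmap c x))"
  proof (rule frechet_derivative_cong_open)
    show "open (cimg c)" "cmap c x \<in> cimg c" using c open_cimg by (auto simp: charts_at_iff)
  qed (simp add: coord_expr_def cmap_cinv)
  then show ?thesis by simp
qed

lemma tangent_space_iff:
  "v \<in> tangent_space A x \<longleftrightarrow>
     (\<forall>c. c \<notin> charts_at A x \<longrightarrow> v c = 0) \<and>
     (\<forall>c\<in>charts_at A x. \<forall>c'\<in>charts_at A x. v c' = coord_deriv id c c' x (v c))"
  unfolding tangent_space_def coord_expr_id mem_Collect_eq by (rule refl)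

lemma tangent_change_chart:
  "v \<in> tangent_space A x \<Longrightarrow> c \<in> charts_at A x \<Longrightarrow> c' \<in> charts_at A x \<Longrightarrow>
     v c' = coord_deriv id c c' x (v c)"
  unfolding tangent_space_iff by blast

lemma tangent_zero_outside: "v \<in> tangent_space A x \<Longrightarrow> c \<notin> charts_at A x \<Longrightarrow> v c = 0"
  unfolding tangent_space_iff by blast

text \<open>The representative in one chart determines all others, so that identities between tangent vectors
can be checked in a chart of choice.\<close>

lemma tangent_eqI:
  assumes "u \<in> tangent_space A x" "v \<in> tangent_space A x" "c \<in> charts_at A x" "u c = v c"
  shows "u = v"
proof (rule ext)
  fix c'
  show "u c' = v c'"
    using tangent_change_chart[OF assms(1,3), of c'] tangent_change_chart[OF assms(2,3), of c']
      tangent_zero_outside[OF assms(1), of c'] tangent_zero_outside[OF assms(2), of c'] assms(4)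
    by (cases "c' \<in> charts_at A x") simp_all
qed

lemma tangent_space_outside:
  "x \<notin> topspace T \<Longrightarrow> tangent_space A x = {tv_zero}"
proof -
  assume "x \<notin> topspace T"
  then have nc: "c \<notin> charts_at A x" for c using charts_at_imp_topspace by blast
  have "v = tv_zero" if "v \<in> tangent_space A x" for v
    unfolding tv_zero_def by (rule ext, rule tangent_zero_outside[OF that nc])
  moreover have "tv_zero \<in> tangent_space A x"
    unfolding tangent_space_iff tv_zero_def using nc by blast
  ultimately show ?thesis by blast
qed

lemma tangent_space_lincomb:
  assumes "u \<in> tangent_space A x" "v \<in> tangent_space A x"
  shows "(\<lambda>c. a *\<^sub>R u c + b *\<^sub>R v c) \<in> tangent_space A x"
  unfolding tangent_space_iff
proof (intro conjI allI impI ballI)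
  fix c c' assume c: "c \<in> charts_at A x" "c' \<in> charts_at A x"
  have "linear (coord_deriv id c c' x)"
    using linear_coord_deriv[OF Ck_map_id] c by auto
  then show "a *\<^sub>R u c' + b *\<^sub>R v c' = coord_deriv id c c' x (a *\<^sub>R u c + b *\<^sub>R v c)"
    by (simp add: linear_add linear_scale tangent_change_chart[OF _ c] assms)
qed (use assms in \<open>simp add: tangent_zero_outside\<close>)

lemma tangent_space_zero: "(\<lambda>c. 0) \<in> tangent_space A x"
proof -
  have "0 = coord_deriv id c c' x 0" if "c \<in> charts_at A x" "c' \<in> charts_at A x" for c c'
    using linear_coord_deriv[OF Ck_map_id] that by (simp add: linear_0)
  then show ?thesis unfolding tangent_space_iff by blast
qed

lemma tangent_space_sum:
  assumes "\<And>i. i \<in> I \<Longrightarrow> F i \<in> tangent_space A x"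
  shows "(\<lambda>c. \<Sum>i\<in>I. a i *\<^sub>R F i c) \<in> tangent_space A x"
  using assms
proof (induction I rule: infinite_finite_induct)
  case (insert i I)
  then show ?case
    using tangent_space_lincomb[of "F i" x "\<lambda>c. \<Sum>i\<in>I. a i *\<^sub>R F i c" "a i" 1] by simp
qed (simp_all add: tangent_space_zero)

lemma coord_vec_eq:
  "coord_vec A c x a c' = (if c' \<in> charts_at A x then coord_deriv id c c' x a else 0)"
  by (simp add: coord_vec_def coord_expr_id)

lemma coord_vec_in_tangent_space:
  assumes c: "c \<in> charts_at A x"
  shows "coord_vec A c x a \<in> tangent_space A x"
  unfolding tangent_space_iff
proof (intro conjI allI impI ballI)
  fix c' c'' assume c': "c' \<in> charts_at A x" "c'' \<in> charts_at A x"
  show "coord_vec A c x a c'' = coord_deriv id c' c'' x (coord_vec A c x a c')"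
    using coord_deriv_compose[OF Ck_map_id Ck_map_id, of c x c' c'' a] c c'
    by (simp add: coord_vec_eq)
qed (simp add: coord_vec_eq)

lemma coord_vec_self: "c \<in> charts_at A x \<Longrightarrow> coord_vec A c x a c = a"
  by (simp add: coord_vec_eq coord_deriv_id)

text \<open>The definition of the tangent map reads \<open>v\<close> in an arbitrarily chosen chart. Passing from \<open>c\<close> to that
chart and applying \<open>f\<close> afterwards is, by the chain rule for \<open>f \<circ> id\<close>, the same as applying \<open>f\<close> in \<open>c\<close>.\<close>

lemma tangent_map_coord:
  assumes f: "Ck_map T A 1 f" and v: "v \<in> tangent_space A x"
    and c: "c \<in> charts_at A x" "c' \<in> charts_at A (f x)"
  shows "tangent_map A f x v c' = coord_deriv f c c' x (v c)"
proof -
  define b where "b = (SOME c. c \<in> charts_at A x)"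
  have b: "b \<in> charts_at A x" unfolding b_def using c(1) by (rule someI)
  have "tangent_map A f x v c' = coord_deriv f b c' x (v b)"
    unfolding tangent_map_def Let_def b_def[symmetric] using c(2) by (simp add: coord_expr_def)
  also have "\<dots> = coord_deriv f b c' x (coord_deriv id c b x (v c))"
    using tangent_change_chart[OF v c(1) b] by simp
  also have "\<dots> = coord_deriv (f \<circ> id) c c' x (v c)"
    using coord_deriv_compose[OF Ck_map_id f, of c x b c'] b c by simp
  finally show ?thesis by simp
qed

lemma tangent_map_outside: "c' \<notin> charts_at A (f x) \<Longrightarrow> tangent_map A f x v c' = 0"
  by (simp add: tangent_map_def Let_def)

lemma tangent_map_in_tangent_space:
  assumes f: "Ck_map T A 1 f" and x: "x \<in> topspace T" and v: "v \<in> tangent_space A x"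
  shows "tangent_map A f x v \<in> tangent_space A (f x)"
  unfolding tangent_space_iff
proof (intro conjI allI impI ballI)
  fix c' c'' assume c': "c' \<in> charts_at A (f x)" "c'' \<in> charts_at A (f x)"
  obtain c where c: "c \<in> charts_at A x" using charts_at_ex[OF x] by blast
  show "tangent_map A f x v c'' = coord_deriv id c' c'' (f x) (tangent_map A f x v c')"
    using coord_deriv_compose[OF f Ck_map_id, of c x c' c'' "v c"] c c'
    by (simp add: tangent_map_coord[OF f v c])
qed (simp add: tangent_map_outside)

lemma tangent_map_compose:
  assumes f: "Ck_map T A 1 f" and g: "Ck_map T A 1 g"
    and x: "x \<in> topspace T" and v: "v \<in> tangent_space A x"
  shows "tangent_map A (g \<circ> f) x v = tangent_map A g (f x) (tangent_map A f x v)"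
proof -
  note fx = Ck_mapD(2)[OF f x]
  obtain c c' c'' where c: "c \<in> charts_at A x" "c' \<in> charts_at A (f x)" "c'' \<in> charts_at A (g (f x))"
    using charts_at_ex x fx Ck_mapD(2)[OF g fx] by metis
  note fv = tangent_map_in_tangent_space[OF f x v]
  show ?thesis
  proof (rule tangent_eqI[OF _ _ c(3)])
    show "tangent_map A (g \<circ> f) x v \<in> tangent_space A (g (f x))"
      using tangent_map_in_tangent_space[OF Ck_map_compose[OF f g] x v] by simp
    show "tangent_map A g (f x) (tangent_map A f x v) \<in> tangent_space A (g (f x))"
      by (rule tangent_map_in_tangent_space[OF g fx fv])
    show "tangent_map A (g \<circ> f) x v c'' = tangent_map A g (f x) (tangent_map A f x v) c''"
      using tangent_map_coord[OF Ck_map_compose[OF f g] v c(1), of c''] c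
      by (simp add: tangent_map_coord[OF g fv c(2,3)] tangent_map_coord[OF f v c(1,2)]
          coord_deriv_compose[OF f g c])
  qed
qed

lemma tangent_map_id:
  assumes x: "x \<in> topspace T" and v: "v \<in> tangent_space A x"
  shows "tangent_map A id x v = v"
proof -
  obtain c where c: "c \<in> charts_at A x" using charts_at_ex[OF x] by blast
  show ?thesis
  proof (rule tangent_eqI[OF _ v c])
    show "tangent_map A id x v \<in> tangent_space A x"
      using tangent_map_in_tangent_space[OF Ck_map_id x v] by simp
    show "tangent_map A id x v c = v c"
      using tangent_map_coord[OF Ck_map_id v c, of c] c by (simp add: coord_deriv_id)
  qed
qed

lemma tangent_map_cong:
  assumes x: "x \<in> topspace T" and eq: "\<And>x. x \<in> topspace T \<Longrightarrow> f x = g x"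
  shows "tangent_map A f x v = tangent_map A g x v"
proof -
  have "(SOME c. c \<in> charts_at A x) \<in> charts_at A x"
    using charts_at_ex[OF x] by (rule someI_ex)
  then have "coord_deriv f (SOME c. c \<in> charts_at A x) c' x
      = coord_deriv g (SOME c. c \<in> charts_at A x) c' x" for c'
    by (rule coord_deriv_cong) (rule eq)
  then show ?thesis
    unfolding tangent_map_def Let_def eq[OF x] by (simp only: coord_expr_def)
qed

lemma tangent_map_lincomb:
  assumes f: "Ck_map T A 1 f" and x: "x \<in> topspace T"
    and uv: "u \<in> tangent_space A x" "v \<in> tangent_space A x"
  shows "tangent_map A f x (\<lambda>c. a *\<^sub>R u c + b *\<^sub>R v c) =
    (\<lambda>c. a *\<^sub>R tangent_map A f x u c + b *\<^sub>R tangent_map A f x v c)"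
proof (rule ext)
  fix c'
  obtain c where c: "c \<in> charts_at A x" using charts_at_ex[OF x] by blast
  show "tangent_map A f x (\<lambda>c. a *\<^sub>R u c + b *\<^sub>R v c) c' =
     a *\<^sub>R tangent_map A f x u c' + b *\<^sub>R tangent_map A f x v c'"
  proof (cases "c' \<in> charts_at A (f x)")
    case True
    have "linear (coord_deriv f c c' x)" by (rule linear_coord_deriv[OF f c True])
    then show ?thesis
      by (simp add: tangent_map_coord[OF f _ c True] uv tangent_space_lincomb linear_add linear_scale)
  qed (simp add: tangent_map_outside)
qed

lemma tangent_map_zero:
  assumes f: "Ck_map T A 1 f" and x: "x \<in> topspace T"
  shows "tangent_map A f x (\<lambda>c. 0) = (\<lambda>c. 0)"
  using tangent_map_lincomb[OF f x tangent_space_zero tangent_space_zero, of 0 0] by simp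

lemma tangent_map_sum:
  assumes f: "Ck_map T A 1 f" and x: "x \<in> topspace T"
    and F: "\<And>i. i \<in> I \<Longrightarrow> F i \<in> tangent_space A x"
  shows "tangent_map A f x (\<lambda>c. \<Sum>i\<in>I. a i *\<^sub>R F i c) =
    (\<lambda>c. \<Sum>i\<in>I. a i *\<^sub>R tangent_map A f x (F i) c)"
  using F
proof (induction I rule: infinite_finite_induct)
  case (insert i I)
  then show ?case
    using tangent_map_lincomb[OF f x, of "F i" "\<lambda>c. \<Sum>i\<in>I. a i *\<^sub>R F i c" "a i" 1]
      tangent_space_sum[of I F x a] by simp
qed (simp_all add: tangent_map_zero[OF f x])

end

section \<open>Pushforward of vector fields\<close>

lemma Cr_tendsto_iff_Ck_lim:
  "Cr_tendsto A r F X G \<longleftrightarrow>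
     (\<forall>c\<in>A. Ck_lim r (cimg c) (\<lambda>s. local_rep c (F s)) (local_rep c X) G)"
  unfolding Cr_tendsto_def Ck_lim_def by (rule refl)

text \<open>The inverse \<open>g\<close> is a parameter of its own. This makes the assumptions symmetric in \<open>f\<close> and \<open>g\<close>, so that
every result about \<open>f\<close> is available for the inverse, too.\<close>

locale manifold_diffeo = manifold_atlas T A
  for T :: "'a topology" and A :: "('a, 'e::euclidean_space) chart set" +
  fixes r :: nat and f g :: "'a \<Rightarrow> 'a"
  assumes Ck_f: "Ck_map T A (Suc r) f" and Ck_g: "Ck_map T A (Suc r) g"
    and g_f: "x \<in> topspace T \<Longrightarrow> g (f x) = x" and f_g: "x \<in> topspace T \<Longrightarrow> f (g x) = x"
begin

lemma inverse_diffeo: "manifold_diffeo T A r g f"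
  by unfold_locales (simp_all add: Ck_f Ck_g g_f f_g)

lemma C1_f: "Ck_map T A 1 f" and C1_g: "Ck_map T A 1 g"
  using Ck_f Ck_g Ck_map_mono by fastforce+

lemmas f_in = Ck_mapD(2)[OF Ck_f] and g_in = Ck_mapD(2)[OF Ck_g]

lemma inv_into_f: "y \<in> topspace T \<Longrightarrow> inv_into (topspace T) f y = g y"
  by (rule inv_into_f_eq) (auto intro!: inj_on_inverseI[of _ g] simp: g_f f_g g_in)

lemma pushforward_at:
  "y \<in> topspace T \<Longrightarrow> pushforward T A f Y y = tangent_map A f (g y) (Y (g y))"
  by (simp add: pushforward_def inv_into_f Let_def)

lemma pushforward_apply:
  "x \<in> topspace T \<Longrightarrow> pushforward T A f Y (f x) = tangent_map A f x (Y x)"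
  by (simp add: pushforward_at f_in g_f)

lemma pushforward_outside: "y \<notin> topspace T \<Longrightarrow> pushforward T A f Y y = tv_zero"
  by (simp add: pushforward_def)

lemma tangent_map_inverse:
  assumes x: "x \<in> topspace T" and v: "v \<in> tangent_space A x"
  shows "tangent_map A g (f x) (tangent_map A f x v) = v"
proof -
  have "tangent_map A g (f x) (tangent_map A f x v) = tangent_map A (g \<circ> f) x v"
    by (rule tangent_map_compose[OF C1_f C1_g x v, symmetric])
  also have "\<dots> = tangent_map A id x v"
    by (rule tangent_map_cong[OF x]) (simp add: g_f)
  finally show ?thesis by (simp add: tangent_map_id[OF x v])
qed

lemma pushforward_in_tangent_space:
  assumes y: "y \<in> topspace T" and Y: "Y (g y) \<in> tangent_space A (g y)"
  shows "pushforward T A f Y y \<in> tangent_space A y"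
  using tangent_map_in_tangent_space[OF C1_f g_in[OF y] Y] y by (simp add: pushforward_at f_g)

lemma pushforward_inverse:
  assumes Y: "\<And>x. Y x \<in> tangent_space A x"
  shows "pushforward T A g (pushforward T A f Y) = Y"
proof (rule ext)
  fix x
  interpret inv: manifold_diffeo T A r g f by (rule inverse_diffeo)
  show "pushforward T A g (pushforward T A f Y) x = Y x"
  proof (cases "x \<in> topspace T")
    case True
    then show ?thesis
      using tangent_map_inverse[OF True Y] by (simp add: inv.pushforward_at pushforward_apply)
  next
    case False
    then show ?thesis
      using Y[of x] by (simp add: inv.pushforward_outside tangent_space_outside)
  qed
qed

text \<open>Linearity makes the pushforward commute with the difference quotients of a path.\<close>

lemma pushforward_lincomb:
  assumes "\<And>x. X x \<in> tangent_space A x" "\<And>x. Y x \<in> tangent_space A x"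
  shows "pushforward T A f (\<lambda>x c. a *\<^sub>R X x c + b *\<^sub>R Y x c) y c =
    a *\<^sub>R pushforward T A f X y c + b *\<^sub>R pushforward T A f Y y c"
proof (cases "y \<in> topspace T")
  case True
  show ?thesis
    by (simp add: pushforward_at[OF True] tangent_map_lincomb[OF C1_f g_in[OF True] assms])
qed (simp add: pushforward_outside tv_zero_def)

text \<open>The coordinate formula \<open>DF(G p) (Y (G p))\<close>, with the coordinate expressions \<open>F\<close> of \<open>f\<close> and \<open>G\<close> of its
inverse. It is written as a composition with \<open>G\<close>, so that the evaluation of \<open>DF\<close> and the substitution of
\<open>G\<close> can be treated one after the other.\<close>

lemma local_rep_pushforward:
  assumes c: "c \<in> A" "c' \<in> A" and p: "p \<in> coord_dom g c' c"
    and Y: "Y (g (cinv c' p)) \<in> tangent_space A (g (cinv c' p))"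
  shows "local_rep c' (pushforward T A f Y) p =
    ((\<lambda>q. frechet_derivative (coord_expr f c c') (at q) (local_rep c Y q)) \<circ> coord_expr g c' c) p"
proof -
  obtain y where y: "y \<in> cdom c'" "g y \<in> cdom c" "p = cmap c' y"
    using p by (auto simp: coord_dom_def)
  have yT: "y \<in> topspace T" using y cdom_subset c by blast
  have "cinv c' p = y" using y c by (simp add: cinv_cmap)
  moreover have "coord_expr g c' c p = cmap c (g y)" using \<open>cinv c' p = y\<close> by (simp add: coord_expr_def)
  moreover have "tangent_map A f (g y) (Y (g y)) c' = coord_deriv f c c' (g y) (Y (g y) c)"
    by (rule tangent_map_coord[OF C1_f]) (use y c Y calculation f_g[OF yT] in \<open>simp_all add: charts_at_iff\<close>)
  ultimately show ?thesis
    using y c by (simp add: local_rep_def pushforward_at[OF yT] cinv_cmap)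
qed

text \<open>The coordinate formula only holds where the inverse maps one chart domain into the other. These open
sets \<open>W\<close> cover the image of \<open>U\<close>; on the corresponding \<open>S\<close> both the coordinate expression of \<open>f\<close> and the
representative of a field over \<open>U\<close> are under control. The set \<open>U\<close> will be the whole manifold for vector
fields and the domain of a local frame for subbundles.\<close>

lemma pushforward_neighbourhood:
  assumes U: "openin T U" and c': "c' \<in> A" and p: "p \<in> cmap c' ` ({y \<in> topspace T. g y \<in> U} \<inter> cdom c')"
  obtains c S W where "c \<in> A" "open S" "open W" "p \<in> W" "W \<subseteq> coord_dom g c' c"
    "S \<subseteq> coord_dom f c c'" "S \<subseteq> cmap c ` (U \<inter> cdom c)"
    "coord_expr g c' c ` W \<subseteq> S" "\<And>q. q \<in> W \<Longrightarrow> g (cinv c' q) \<in> U"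
proof -
  obtain y where y: "y \<in> topspace T" "g y \<in> U" "y \<in> cdom c'" "p = cmap c' y" using p by blast
  obtain c where "c \<in> charts_at A (g y)" using charts_at_ex[OF g_in[OF y(1)]] by blast
  then have c: "c \<in> A" "g y \<in> cdom c" by (simp_all add: charts_at_iff)
  note contf = Ck_mapD(1)[OF Ck_f] and contg = Ck_mapD(1)[OF Ck_g]
  let ?V = "{x \<in> U \<inter> cdom c. f x \<in> cdom c'}"
  let ?S = "cmap c ` ?V" and ?W = "cmap c' ` {y \<in> cdom c'. g y \<in> U \<inter> cdom c}"
  have oU: "openin T (U \<inter> cdom c)" by (intro openin_Int U openin_cdom c)
  have "openin T ?V" by (rule openin_preimage[OF contf oU openin_cdom[OF c']])
  then have S: "open ?S" by (rule open_cmap_image[OF c(1)]) blast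
  have "openin T {y \<in> cdom c'. g y \<in> U \<inter> cdom c}"
    by (rule openin_preimage[OF contg openin_cdom[OF c'] oU])
  then have W: "open ?W" by (rule open_cmap_image[OF c']) blast
  show thesis
  proof (rule that[of c ?S ?W])
    show "coord_expr g c' c ` ?W \<subseteq> ?S"
    proof (rule image_subsetI)
      fix q assume "q \<in> ?W"
      then obtain z where z: "z \<in> cdom c'" "g z \<in> U" "g z \<in> cdom c" "q = cmap c' z" by blast
      then have "coord_expr g c' c q = cmap c (g z)" using c' by (simp add: coord_expr_def cinv_cmap)
      moreover have "f (g z) = z" using z cdom_subset[OF c'] f_g by blast
      ultimately show "coord_expr g c' c q \<in> ?S" using z by auto
    qed
    show "g (cinv c' q) \<in> U" if "q \<in> ?W" for q
      using that c' by (auto simp: cinv_cmap)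
  qed (use c y S W in \<open>auto simp: coord_dom_def\<close>)
qed

text \<open>Used with \<open>k = r\<close> for vector fields on the manifold, and with \<open>k = 0\<close> for continuous local frames.\<close>

lemma pushforward_local_Ck:
  assumes k: "k \<le> r" and U: "openin T U" and Y: "\<And>x. x \<in> U \<Longrightarrow> Y x \<in> tangent_space A x"
    and Ck: "\<And>c. c \<in> A \<Longrightarrow> Ck_on k (cmap c ` (U \<inter> cdom c)) (local_rep c Y)" and c': "c' \<in> A"
  shows "Ck_on k (cmap c' ` ({y \<in> topspace T. g y \<in> U} \<inter> cdom c')) (local_rep c' (pushforward T A f Y))"
proof (rule Ck_on_local)
  fix p assume "p \<in> cmap c' ` ({y \<in> topspace T. g y \<in> U} \<inter> cdom c')"
  then obtain c S W where c: "c \<in> A" and S: "open S" and W: "open W" "p \<in> W" "W \<subseteq> coord_dom g c' c"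
    and Ssub: "S \<subseteq> coord_dom f c c'" "S \<subseteq> cmap c ` (U \<inter> cdom c)"
    and into: "coord_expr g c' c ` W \<subseteq> S" and WU: "\<And>q. q \<in> W \<Longrightarrow> g (cinv c' q) \<in> U"
    by (rule pushforward_neighbourhood[OF U c']) (rule that)
  let ?D = "\<lambda>q. frechet_derivative (coord_expr f c c') (at q) (local_rep c Y q)"
  have "Ck_on (Suc k) S (coord_expr f c c')"
    using Ck_on_mono[OF Ck_on_subset[OF Ck_mapD(3)[OF Ck_f c c'] Ssub(1)]] k by simp
  then have "Ck_on k S ?D"
    by (rule Ck_on_derivative_apply[OF S _ Ck_on_subset[OF Ck[OF c] Ssub(2)]])
  moreover have "Ck_on k W (coord_expr g c' c)"
    using Ck_on_mono[OF Ck_on_subset[OF Ck_mapD(3)[OF Ck_g c' c] W(3)]] k by simp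
  ultimately have "Ck_on k W (?D \<circ> coord_expr g c' c)"
    by (rule Ck_on_compose[OF W(1) _ _ into])
  moreover have "local_rep c' (pushforward T A f Y) q = (?D \<circ> coord_expr g c' c) q" if "q \<in> W" for q
    by (rule local_rep_pushforward[OF c c' subsetD[OF W(3) that]]) (rule Y[OF WU[OF that]])
  ultimately have "Ck_on k W (local_rep c' (pushforward T A f Y))"
    by (subst Ck_on_cong[OF W(1)])
  with W show "\<exists>W. open W \<and> p \<in> W \<and> Ck_on k W (local_rep c' (pushforward T A f Y))" by blast
qed

lemma Cr_fieldsD:
  assumes "X \<in> Cr_fields A r"
  shows "X x \<in> tangent_space A x" and "c \<in> A \<Longrightarrow> Ck_on r (cimg c) (local_rep c X)"
  using assms unfolding Cr_fields_def by blast+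

lemma pushforward_Cr_fields:
  assumes X: "X \<in> Cr_fields A r"
  shows "pushforward T A f X \<in> Cr_fields A r"
proof -
  have "Ck_on r (cimg c') (local_rep c' (pushforward T A f X))" if c': "c' \<in> A" for c'
  proof -
    have "Ck_on r (cmap c ` (topspace T \<inter> cdom c)) (local_rep c X)" if "c \<in> A" for c
      using Cr_fieldsD(2)[OF X that] cdom_subset[OF that] by (simp add: inf.absorb2)
    from pushforward_local_Ck[OF order_refl openin_topspace Cr_fieldsD(1)[OF X] this c']
    have "Ck_on r (cmap c' ` ({y \<in> topspace T. g y \<in> topspace T} \<inter> cdom c'))
        (local_rep c' (pushforward T A f X))" .
    moreover have "{y \<in> topspace T. g y \<in> topspace T} \<inter> cdom c' = cdom c'"
      using g_in cdom_subset[OF c'] by blast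
    ultimately show ?thesis by simp
  qed
  moreover have "pushforward T A f X x \<in> tangent_space A x" for x
    using Cr_fieldsD(1)[OF X] pushforward_in_tangent_space[of x X]
    by (cases "x \<in> topspace T") (simp_all add: pushforward_outside tangent_space_outside)
  ultimately show ?thesis unfolding Cr_fields_def by blast
qed

text \<open>Continuity of \<open>f\<^sub>*\<close> in the \<open>C\<^sup>r\<close> topology: on the sets \<open>W\<close> above, the coordinate formula composes two
operators that preserve \<open>C\<^sup>r\<close> limits.\<close>

lemma pushforward_Cr_tendsto:
  assumes lim: "Cr_tendsto A r F X G" and F: "\<forall>\<^sub>F s in G. F s \<in> Cr_fields A r"
    and X: "X \<in> Cr_fields A r"
  shows "Cr_tendsto A r (\<lambda>s. pushforward T A f (F s)) (pushforward T A f X) G"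
  unfolding Cr_tendsto_iff_Ck_lim
proof (intro ballI Ck_lim_local)
  fix c' p assume c': "c' \<in> A" and p: "p \<in> cimg c'"
  have "cdom c' \<subseteq> {y \<in> topspace T. g y \<in> topspace T}"
    using g_in cdom_subset[OF c'] by blast
  with p have "p \<in> cmap c' ` ({y \<in> topspace T. g y \<in> topspace T} \<inter> cdom c')" by blast
  then obtain c S W where c: "c \<in> A" and S: "open S" and W: "open W" "p \<in> W" "W \<subseteq> coord_dom g c' c"
    and Ssub: "S \<subseteq> coord_dom f c c'" "S \<subseteq> cmap c ` (topspace T \<inter> cdom c)"
    and into: "coord_expr g c' c ` W \<subseteq> S"
    by (rule pushforward_neighbourhood[OF openin_topspace c']) (rule that)
  let ?D = "\<lambda>Y q. frechet_derivative (coord_expr f c c') (at q) (local_rep c Y q)"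
  have Scimg: "S \<subseteq> cimg c" using Ssub(2) by blast
  have Ckf: "Ck_on (Suc r) S (coord_expr f c c')"
    by (rule Ck_on_subset[OF Ck_mapD(3)[OF Ck_f c c'] Ssub(1)])
  have Ckg: "Ck_on r W (coord_expr g c' c)"
    by (rule Ck_on_mono[OF Ck_on_subset[OF Ck_mapD(3)[OF Ck_g c' c] W(3)]]) simp
  have rep: "Ck_on r S (local_rep c Y)" if "Y \<in> Cr_fields A r" for Y
    by (rule Ck_on_subset[OF Cr_fieldsD(2)[OF that c] Scimg])
  have D: "Ck_on r S (?D Y)" if "Y \<in> Cr_fields A r" for Y
    by (rule Ck_on_derivative_apply[OF S Ckf rep[OF that]])
  have "Ck_lim r (cimg c) (\<lambda>s. local_rep c (F s)) (local_rep c X) G"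
    using lim c unfolding Cr_tendsto_iff_Ck_lim by blast
  then have "Ck_lim r S (\<lambda>s. local_rep c (F s)) (local_rep c X) G"
    by (rule Ck_lim_subset[OF _ Scimg])
  moreover have "\<forall>\<^sub>F s in G. Ck_on r S (local_rep c (F s))"
    using F by eventually_elim (rule rep)
  ultimately have "Ck_lim r S (\<lambda>s. ?D (F s)) (?D X) G"
    by (rule Ck_lim_derivative_apply[OF S Ckf _ _ rep[OF X]])
  moreover have "\<forall>\<^sub>F s in G. Ck_on r S (?D (F s))"
    using F by eventually_elim (rule D)
  ultimately have "Ck_lim r W (\<lambda>s. ?D (F s) \<circ> coord_expr g c' c) (?D X \<circ> coord_expr g c' c) G"
    by (rule Ck_lim_compose[OF W(1) _ _ D[OF X] Ckg into])
  moreover have eq: "local_rep c' (pushforward T A f Y) q = (?D Y \<circ> coord_expr g c' c) q"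
    if "Y \<in> Cr_fields A r" "q \<in> W" for Y q
    using Cr_fieldsD(1)[OF that(1)] by (rule local_rep_pushforward[OF c c' subsetD[OF W(3) that(2)]])
  moreover have "\<forall>\<^sub>F s in G. \<forall>q\<in>W. local_rep c' (pushforward T A f (F s)) q =
      (?D (F s) \<circ> coord_expr g c' c) q"
    using F by eventually_elim (use eq in blast)
  ultimately have "Ck_lim r W (\<lambda>s. local_rep c' (pushforward T A f (F s))) (local_rep c' (pushforward T A f X)) G"
    using X by (subst Ck_lim_cong[OF W(1)])
  with W show "\<exists>W. open W \<and> p \<in> W \<and> Ck_lim r W (\<lambda>s. local_rep c' (pushforward T A f (F s)))
      (local_rep c' (pushforward T A f X)) G" by blast
qed

end

section \<open>Invariance of the Anosov condition\<close>

lemma ex1_triple: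
  "(\<exists>!(u, w, a). P u w a) \<longleftrightarrow>
     (\<exists>u w a. P u w a \<and> (\<forall>u' w' a'. P u' w' a' \<longrightarrow> u' = u \<and> w' = w \<and> a' = a))"
  by (simp add: Ex1_def split_paired_Ex split_paired_All)

context manifold_atlas
begin

text \<open>This identifies continuous frames with frames whose local representatives are of class \<open>C\<^sup>0\<close>, to which
\<open>pushforward_local_Ck\<close> applies.\<close>

lemma continuous_map_chart_iff:
  assumes c: "c \<in> A" and V: "openin T V" "V \<subseteq> cdom c"
  shows "continuous_map (subtopology T V) euclidean h \<longleftrightarrow> continuous_on (cmap c ` V) (h \<circ> cinv c)"
proof
  assume h: "continuous_map (subtopology T V) euclidean h"
  have "continuous_map (top_of_set (cmap c ` V)) T (cinv c)"
    by (rule continuous_map_from_subtopology_mono[OF continuous_map_cinv[OF c]]) (use V in blast)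
  moreover have "cinv c \<in> cmap c ` V \<rightarrow> V"
    using V(2) cinv_cmap[OF c] by (simp add: Pi_iff subset_iff)
  ultimately have "continuous_map (top_of_set (cmap c ` V)) (subtopology T V) (cinv c)"
    by (simp add: continuous_map_in_subtopology)
  from continuous_map_compose[OF this h] show "continuous_on (cmap c ` V) (h \<circ> cinv c)"
    by simp
next
  assume h: "continuous_on (cmap c ` V) (h \<circ> cinv c)"
  have "continuous_map (subtopology T V) euclidean (cmap c)"
    by (rule continuous_map_from_subtopology_mono[OF continuous_map_cmap[OF c] V(2)])
  then have "continuous_map (subtopology T V) (top_of_set (cmap c ` V)) (cmap c)"
    by (simp add: continuous_map_in_subtopology)
  moreover have "continuous_map (top_of_set (cmap c ` V)) euclidean (h \<circ> cinv c)"
    using h by simp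
  ultimately have "continuous_map (subtopology T V) euclidean ((h \<circ> cinv c) \<circ> cmap c)"
    by (rule continuous_map_compose)
  moreover have "((h \<circ> cinv c) \<circ> cmap c) x = h x" if "x \<in> topspace (subtopology T V)" for x
    using that V(2) cinv_cmap[OF c] by auto
  ultimately show "continuous_map (subtopology T V) euclidean h"
    by (rule continuous_map_eq)
qed

lemma continuous_subbundleE:
  assumes E: "continuous_subbundle T A E" and x0: "x0 \<in> topspace T"
  obtains U and m :: nat and F where "openin T U" "x0 \<in> U"
    "\<And>i x. i < m \<Longrightarrow> x \<in> U \<Longrightarrow> F i x \<in> tangent_space A x"
    "\<And>i c. i < m \<Longrightarrow> c \<in> A \<Longrightarrow>
        continuous_map (subtopology T (U \<inter> cdom c)) euclidean (\<lambda>x. F i x c)"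
    "\<And>x. x \<in> U \<Longrightarrow> E x = range (\<lambda>a::nat \<Rightarrow> real. \<lambda>c. \<Sum>i<m. a i *\<^sub>R F i x c)"
    "\<And>x a i. x \<in> U \<Longrightarrow> (\<lambda>c. \<Sum>i<m. a i *\<^sub>R F i x c) = tv_zero \<Longrightarrow> i < m \<Longrightarrow> a i = 0"
proof -
  from bspec[OF E[unfolded continuous_subbundle_def] x0]
  obtain U and m :: nat and F where U: "openin T U" "x0 \<in> U"
    and F: "\<forall>i<m. (\<forall>x\<in>U. F i x \<in> tangent_space A x) \<and>
       (\<forall>c\<in>A. continuous_map (subtopology T (U \<inter> cdom c)) euclidean (\<lambda>x. F i x c))"
    and E: "\<forall>x\<in>U. E x = range (\<lambda>a::nat \<Rightarrow> real. \<lambda>c. \<Sum>i<m. a i *\<^sub>R F i x c) \<and>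
       (\<forall>a::nat \<Rightarrow> real. (\<lambda>c. \<Sum>i<m. a i *\<^sub>R F i x c) = tv_zero \<longrightarrow> (\<forall>i<m. a i = 0))"
    by (elim exE conjE) (rule that)
  show thesis
  proof (rule that[OF U])
    show "F i x \<in> tangent_space A x" if "i < m" "x \<in> U" for i x
      using F that by blast
    show "continuous_map (subtopology T (U \<inter> cdom c)) euclidean (\<lambda>x. F i x c)"
      if "i < m" "c \<in> A" for i c
      using F that by blast
    show "E x = range (\<lambda>a::nat \<Rightarrow> real. \<lambda>c. \<Sum>i<m. a i *\<^sub>R F i x c)" if "x \<in> U" for x
      using bspec[OF E that] by (rule conjunct1)
    show "a i = 0" if "x \<in> U" "(\<lambda>c. \<Sum>i<m. a i *\<^sub>R F i x c) = tv_zero" "i < m" for x a i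
      using bspec[OF E that(1), THEN conjunct2, THEN spec, THEN mp, OF that(2)] that(3) by blast
  qed
qed

lemma subbundle_subset:
  assumes E: "continuous_subbundle T A E" and x: "x \<in> topspace T"
  shows "E x \<subseteq> tangent_space A x"
proof (rule continuous_subbundleE[OF E x])
  fix U and m :: nat and F
  assume U: "x \<in> U"
    and F: "\<And>i x. i < m \<Longrightarrow> x \<in> U \<Longrightarrow> F i x \<in> tangent_space A x"
    and E: "\<And>x. x \<in> U \<Longrightarrow> E x = range (\<lambda>a::nat \<Rightarrow> real. \<lambda>c. \<Sum>i<m. a i *\<^sub>R F i x c)"
  show "E x \<subseteq> tangent_space A x"
    unfolding E[OF U] by (rule image_subsetI, rule tangent_space_sum) (use U F in simp)
qed

end

context manifold_diffeo
begin

text \<open>The pushforward of a local frame is a local frame. Its linear independence holds because the tangent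
map of the inverse takes it back to the original frame.\<close>

lemma pushforward_subbundle:
  assumes E: "continuous_subbundle T A E"
  shows "continuous_subbundle T A (\<lambda>y. tangent_map A f (g y) ` E (g y))"
  unfolding continuous_subbundle_def
proof (rule ballI)
  fix y0 assume y0: "y0 \<in> topspace T"
  obtain U and m :: nat and F where
    U: "openin T U" "g y0 \<in> U"
    and F: "\<And>i x. i < m \<Longrightarrow> x \<in> U \<Longrightarrow> F i x \<in> tangent_space A x"
    and cont: "\<And>i c. i < m \<Longrightarrow> c \<in> A \<Longrightarrow> continuous_map (subtopology T (U \<inter> cdom c)) euclidean (\<lambda>x. F i x c)"
    and span: "\<And>x. x \<in> U \<Longrightarrow> E x = range (\<lambda>a::nat \<Rightarrow> real. \<lambda>c. \<Sum>i<(m::nat). a i *\<^sub>R F i x c)"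
    and indep: "\<And>x a i. x \<in> U \<Longrightarrow> (\<lambda>c. \<Sum>i<m. a i *\<^sub>R F i x c) = tv_zero \<Longrightarrow> i < m \<Longrightarrow> a i = 0"
    using E g_in[OF y0] by (rule continuous_subbundleE) (rule that)
  let ?U = "{y \<in> topspace T. g y \<in> U}" and ?F = "\<lambda>i. pushforward T A f (F i)"
  have oU: "openin T ?U" by (rule openin_preimage[OF Ck_mapD(1)[OF Ck_g] openin_topspace U(1)])
  have F': "?F i y = tangent_map A f (g y) (F i (g y))" if "y \<in> ?U" for i y
    using that by (simp add: pushforward_at)
  have FT: "?F i y \<in> tangent_space A y" if "i < m" "y \<in> ?U" for i y
    using that F by (intro pushforward_in_tangent_space) auto
  have contF: "continuous_map (subtopology T (?U \<inter> cdom c')) euclidean (\<lambda>y. ?F i y c')"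
    if i: "i < m" and c': "c' \<in> A" for i c'
  proof -
    have "Ck_on 0 (cmap c ` (U \<inter> cdom c)) (local_rep c (F i))" if c: "c \<in> A" for c
      using cont[OF i c] openin_Int[OF U(1) openin_cdom[OF c]]
      by (subst (asm) continuous_map_chart_iff[OF c]) (auto simp: Ck_on_0 local_rep_def o_def)
    from pushforward_local_Ck[OF _ U(1) F[OF i] this c']
    have "continuous_on (cmap c' ` (?U \<inter> cdom c')) (local_rep c' (?F i))"
      by (simp add: Ck_on_0)
    then show ?thesis
      using openin_Int[OF oU openin_cdom[OF c']]
      by (subst continuous_map_chart_iff[OF c']) (auto simp: local_rep_def o_def)
  qed
  have sum: "tangent_map A f (g y) (\<lambda>c. \<Sum>i<m. a i *\<^sub>R F i (g y) c) = (\<lambda>c. \<Sum>i<m. a i *\<^sub>R ?F i y c)"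
    if "y \<in> ?U" for a y
    using that F by (subst tangent_map_sum[OF C1_f]) (auto simp: g_in F')
  have span': "tangent_map A f (g y) ` E (g y) = range (\<lambda>a::nat \<Rightarrow> real. \<lambda>c. \<Sum>i<m. a i *\<^sub>R ?F i y c)"
    if "y \<in> ?U" for y
    using that span[of "g y"] sum[OF that] by (simp add: image_image)
  have indep': "a i = 0" if y: "y \<in> ?U" and zero: "(\<lambda>c. \<Sum>i<m. a i *\<^sub>R ?F i y c) = tv_zero" and i: "i < m" for y a i
  proof -
    let ?v = "\<lambda>c. \<Sum>i<m. a i *\<^sub>R F i (g y) c"
    have gy: "g y \<in> topspace T" "g y \<in> U" "f (g y) = y" using y by (auto simp: g_in f_g)
    have v: "?v \<in> tangent_space A (g y)" using F gy by (intro tangent_space_sum) auto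
    have "?v = tangent_map A g y (tangent_map A f (g y) ?v)"
      using tangent_map_inverse[OF gy(1) v] gy(3) by simp
    also have "\<dots> = tv_zero"
      using tangent_map_zero[OF C1_g, of y] y zero unfolding sum[OF y] by (simp add: tv_zero_def)
    finally show "a i = 0" by (rule indep[OF gy(2) _ i])
  qed
  show "\<exists>U (m::nat) F.
        openin T U \<and> y0 \<in> U \<and>
        (\<forall>i<m. (\<forall>x\<in>U. F i x \<in> tangent_space A x) \<and>
               (\<forall>c\<in>A. continuous_map (subtopology T (U \<inter> cdom c)) euclidean (\<lambda>x. F i x c))) \<and>
        (\<forall>x\<in>U. tangent_map A f (g x) ` E (g x) = range (\<lambda>a::nat \<Rightarrow> real. \<lambda>c. \<Sum>i<m. a i *\<^sub>R F i x c) \<and>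
               (\<forall>a::nat \<Rightarrow> real.
                  (\<lambda>c. \<Sum>i<m. a i *\<^sub>R F i x c) = tv_zero \<longrightarrow> (\<forall>i<m. a i = 0)))"
  proof (rule exI[of _ ?U], rule exI[of _ m], rule exI[of _ ?F], intro conjI allI impI ballI)
    show "y0 \<in> ?U" using y0 U(2) by simp
  qed (fact oU FT contF span' indep')+
qed

lemma tangent_map_splitting:
  assumes x: "x \<in> topspace T" and "u \<in> tangent_space A x" "w \<in> tangent_space A x" "z \<in> tangent_space A x"
  shows "tangent_map A f x (tv_add (tv_add u w) (tv_scale a z)) =
    tv_add (tv_add (tangent_map A f x u) (tangent_map A f x w)) (tv_scale a (tangent_map A f x z))"
proof -
  have uw: "(\<lambda>c. u c + w c) \<in> tangent_space A x"
    using tangent_space_lincomb[OF assms(2,3), of 1 1] by simp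
  show ?thesis
    using tangent_map_lincomb[OF C1_f x uw assms(4), of 1 a] tangent_map_lincomb[OF C1_f x assms(2,3), of 1 1]
    by (simp add: tv_add_def tv_scale_def)
qed

text \<open>The tangent map of \<open>f\<close> is a linear isomorphism that maps the three summands at \<open>g y\<close> to those at \<open>y\<close>;
existence and uniqueness of the decomposition of \<open>v\<close> follow from those for the preimage of \<open>v\<close>.\<close>

lemma pushforward_flow_splitting:
  assumes split: "flow_splitting T A X Es Eu" and X: "\<And>x. X x \<in> tangent_space A x"
  shows "flow_splitting T A (pushforward T A f X)
     (\<lambda>y. tangent_map A f (g y) ` Es (g y)) (\<lambda>y. tangent_map A f (g y) ` Eu (g y))"
proof -
  have sub: "continuous_subbundle T A Es" "continuous_subbundle T A Eu"
    using split unfolding flow_splitting_def by blast+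
  interpret inv: manifold_diffeo T A r g f by (rule inverse_diffeo)
  have "\<exists>!(u, w, a). u \<in> tangent_map A f (g y) ` Es (g y) \<and> w \<in> tangent_map A f (g y) ` Eu (g y) \<and>
      v = tv_add (tv_add u w) (tv_scale a (pushforward T A f X y))"
    if y: "y \<in> topspace T" and v: "v \<in> tangent_space A y" for y v
  proof -
    let ?x = "g y" and ?Tf = "tangent_map A f (g y)" and ?Tg = "tangent_map A g y"
    have x: "?x \<in> topspace T" and fx: "f ?x = y" using y by (simp_all add: g_in f_g)
    have TgTf: "?Tg (?Tf z) = z" if "z \<in> tangent_space A ?x" for z
      using tangent_map_inverse[OF x that] fx by simp
    have TfTg: "?Tf (?Tg v) = v" using inv.tangent_map_inverse[OF y v] by simp
    have Es: "u \<in> tangent_space A ?x" if "u \<in> Es ?x" for u using subbundle_subset[OF sub(1) x] that by blast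
    have Eu: "u \<in> tangent_space A ?x" if "u \<in> Eu ?x" for u using subbundle_subset[OF sub(2) x] that by blast
    have "?Tg v \<in> tangent_space A ?x" by (rule tangent_map_in_tangent_space[OF C1_g y v])
    then have "\<exists>!(u, w, a). u \<in> Es ?x \<and> w \<in> Eu ?x \<and> ?Tg v = tv_add (tv_add u w) (tv_scale a (X ?x))"
      using split x unfolding flow_splitting_def by blast
    then obtain u w a where uw: "u \<in> Es ?x" "w \<in> Eu ?x"
        "?Tg v = tv_add (tv_add u w) (tv_scale a (X ?x))"
      and uniq: "\<And>u' w' a'. u' \<in> Es ?x \<Longrightarrow> w' \<in> Eu ?x \<Longrightarrow>
          ?Tg v = tv_add (tv_add u' w') (tv_scale a' (X ?x)) \<Longrightarrow> u' = u \<and> w' = w \<and> a' = a"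
      unfolding ex1_triple by blast
    note Tf_sum = tangent_map_splitting[OF x Es Eu X]
    show ?thesis
      unfolding ex1_triple
    proof (intro exI conjI allI impI)
      show "?Tf u \<in> ?Tf ` Es ?x" "?Tf w \<in> ?Tf ` Eu ?x" using uw by blast+
      show "v = tv_add (tv_add (?Tf u) (?Tf w)) (tv_scale a (pushforward T A f X y))"
        using TfTg Tf_sum[OF uw(1,2), of a] uw(3) by (simp add: pushforward_at[OF y])
    next
      fix u2 w2 a' assume "u2 \<in> ?Tf ` Es ?x \<and> w2 \<in> ?Tf ` Eu ?x \<and>
          v = tv_add (tv_add u2 w2) (tv_scale a' (pushforward T A f X y))"
      then obtain u' w' where z': "u2 = ?Tf u'" "w2 = ?Tf w'" "u' \<in> Es ?x" "w' \<in> Eu ?x"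
          "v = tv_add (tv_add (?Tf u') (?Tf w')) (tv_scale a' (pushforward T A f X y))"
        by blast
      have "v = ?Tf (tv_add (tv_add u' w') (tv_scale a' (X ?x)))"
        unfolding Tf_sum[OF z'(3,4)] z'(5)[symmetric] pushforward_at[OF y, symmetric] by (rule refl)
      moreover have "tv_add (tv_add u' w') (tv_scale a' (X ?x)) \<in> tangent_space A ?x"
        using tangent_space_lincomb[OF tangent_space_lincomb[OF Es[OF z'(3)] Eu[OF z'(4)], of 1 1] X, of 1 a']
        by (simp add: tv_add_def tv_scale_def)
      ultimately have "?Tg v = tv_add (tv_add u' w') (tv_scale a' (X ?x))"
        using TgTf by simp
      from uniq[OF z'(3,4) this] show "u2 = ?Tf u" "w2 = ?Tf w" "a' = a" using z' by simp_all
    qed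
  qed
  then show ?thesis
    unfolding flow_splitting_def by (intro conjI ballI pushforward_subbundle sub)
qed

text \<open>On vectors that come from \<open>g y\<close> through \<open>f\<close>, the conjugate map acts as \<open>\<psi>\<close> followed by \<open>f\<close>. This transfers
both the invariance of the bundles and the contraction estimates.\<close>

lemma conjugate_tangent_map:
  assumes \<psi>: "Ck_map T A 1 \<psi>" and y: "y \<in> topspace T" and v: "v \<in> tangent_space A (g y)"
  shows "tangent_map A (f \<circ> \<psi> \<circ> g) y (tangent_map A f (g y) v) =
     tangent_map A f (\<psi> (g y)) (tangent_map A \<psi> (g y) v)"
proof -
  note x = g_in[OF y]
  have fx: "f (g y) = y" by (rule f_g[OF y])
  have Tfv: "tangent_map A f (g y) v \<in> tangent_space A y"
    using tangent_map_in_tangent_space[OF C1_f x v] fx by simp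
  have "tangent_map A (f \<circ> \<psi> \<circ> g) y (tangent_map A f (g y) v) =
      tangent_map A (f \<circ> \<psi>) (g y) (tangent_map A g y (tangent_map A f (g y) v))"
    by (rule tangent_map_compose[OF C1_g Ck_map_compose[OF \<psi> C1_f] y Tfv])
  also have "tangent_map A g y (tangent_map A f (g y) v) = v"
    using tangent_map_inverse[OF x v] fx by simp
  also have "tangent_map A (f \<circ> \<psi>) (g y) v = tangent_map A f (\<psi> (g y)) (tangent_map A \<psi> (g y) v)"
    by (rule tangent_map_compose[OF \<psi> C1_f x v])
  finally show ?thesis .
qed

text \<open>Near \<open>t\<close> the orbit stays in one chart \<open>c\<close>, where the conjugate orbit is the image of the orbit under the
coordinate expression of \<open>f\<close>; the chain rule then turns the differential equation of \<open>\<phi>\<close> into that of the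
conjugate flow.\<close>

lemma pushforward_flow:
  assumes flow: "flow_of T A r X \<phi>" and X: "\<And>x. X x \<in> tangent_space A x"
  shows "flow_of T A r (pushforward T A f X) (\<lambda>t. f \<circ> \<phi> t \<circ> g)"
proof -
  have cont: "continuous_map (prod_topology euclideanreal T) T (\<lambda>(t, x). \<phi> t x)"
    and Ck: "\<And>t. Ck_map T A r (\<phi> t)"
    and zero: "\<And>x. x \<in> topspace T \<Longrightarrow> \<phi> 0 x = x"
    and add: "\<And>x s t. x \<in> topspace T \<Longrightarrow> \<phi> (s + t) x = \<phi> s (\<phi> t x)"
    and ode: "\<And>x t c. x \<in> topspace T \<Longrightarrow> c \<in> charts_at A (\<phi> t x) \<Longrightarrow>
        ((\<lambda>s. cmap c (\<phi> s x)) has_vector_derivative X (\<phi> t x) c) (at t)"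
    using flow unfolding flow_of_def by blast+
  have \<phi>_in: "\<phi> t x \<in> topspace T" if "x \<in> topspace T" for t x
    by (rule Ck_mapD(2)[OF Ck that])
  have "continuous_map (prod_topology euclideanreal T) T (\<lambda>(t, y). (f \<circ> \<phi> t \<circ> g) y)"
  proof -
    have "continuous_map (prod_topology euclideanreal T) (prod_topology euclideanreal T) (\<lambda>z. (fst z, g (snd z)))"
      by (intro continuous_map_pairedI continuous_map_fst
          continuous_map_compose[OF continuous_map_snd Ck_mapD(1)[OF Ck_g], unfolded o_def])
    from continuous_map_compose[OF continuous_map_compose[OF this cont] Ck_mapD(1)[OF Ck_f]]
    show ?thesis by (simp add: o_def case_prod_unfold)
  qed
  moreover have "Ck_map T A r (f \<circ> \<phi> t \<circ> g)" for t
    using Ck_map_mono[OF Ck_f, of r] Ck_map_mono[OF Ck_g, of r] Ck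
    by (intro Ck_map_compose) simp_all
  moreover have "((\<lambda>s. cmap c' ((f \<circ> \<phi> s \<circ> g) y)) has_vector_derivative
      pushforward T A f X ((f \<circ> \<phi> t \<circ> g) y) c') (at t)"
    if y: "y \<in> topspace T" and c': "c' \<in> charts_at A ((f \<circ> \<phi> t \<circ> g) y)" for y t c'
  proof -
    let ?x = "\<phi> t (g y)"
    note gy = g_in[OF y]
    have x: "?x \<in> topspace T" by (rule \<phi>_in[OF gy])
    obtain c where c: "c \<in> charts_at A ?x" using charts_at_ex[OF x] by blast
    have cA: "c \<in> A" using c by (simp add: charts_at_iff)
    have c'f: "c' \<in> charts_at A (f ?x)" using c' by simp
    define J where "J = {s. \<phi> s (g y) \<in> cdom c}"
    have "continuous_map euclideanreal (prod_topology euclideanreal T) (\<lambda>s. (s, g y))"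
      using gy by (intro continuous_map_pairedI) auto
    from continuous_map_compose[OF this cont]
    have "continuous_map euclideanreal T (\<lambda>s. \<phi> s (g y))" by (simp add: o_def)
    from openin_continuous_map_preimage[OF this openin_cdom[OF cA]]
    have J: "open J" "t \<in> J" using c by (simp_all add: J_def charts_at_iff)
    have "((\<lambda>s. coord_expr f c c' (cmap c (\<phi> s (g y)))) has_derivative
        (\<lambda>h. coord_deriv f c c' ?x (h *\<^sub>R X ?x c))) (at t)"
      by (rule has_derivative_compose[OF ode[OF gy c, unfolded has_vector_derivative_def]
            coord_expr_has_derivative[OF C1_f c c'f]])
    moreover have "coord_expr f c c' (cmap c (\<phi> s (g y))) = cmap c' ((f \<circ> \<phi> s \<circ> g) y)" if "s \<in> J" for s
      using that cA by (simp add: J_def coord_expr_def cinv_cmap)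
    ultimately have "((\<lambda>s. cmap c' ((f \<circ> \<phi> s \<circ> g) y)) has_derivative
        (\<lambda>h. coord_deriv f c c' ?x (h *\<^sub>R X ?x c))) (at t)"
      by (rule has_derivative_transform_within_open[OF _ J])
    moreover have "pushforward T A f X ((f \<circ> \<phi> t \<circ> g) y) c' = coord_deriv f c c' ?x (X ?x c)"
      using pushforward_apply[OF x, of X] tangent_map_coord[OF C1_f X c c'f] by simp
    ultimately show ?thesis
      unfolding has_vector_derivative_def
      by (simp add: linear_scale[OF linear_coord_deriv[OF C1_f c c'f]])
  qed
  moreover have "(f \<circ> \<phi> 0 \<circ> g) y = y" if "y \<in> topspace T" for y
    using that by (simp add: zero g_in f_g)
  moreover have "(f \<circ> \<phi> (s + t) \<circ> g) y = (f \<circ> \<phi> s \<circ> g) ((f \<circ> \<phi> t \<circ> g) y)"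
    if "y \<in> topspace T" for y s t
    using that by (simp add: add g_in g_f \<phi>_in)
  ultimately show ?thesis
    unfolding flow_of_def by (intro conjI allI ballI)
qed

lemma riemannian_metricD:
  assumes h: "riemannian_metric A m h"
  shows "\<not> (u \<in> tangent_space A x \<and> v \<in> tangent_space A x) \<Longrightarrow> h x u v = 0"
    and "u \<in> tangent_space A x \<Longrightarrow> v \<in> tangent_space A x \<Longrightarrow> h x u v = h x v u"
    and "u \<in> tangent_space A x \<Longrightarrow> v \<in> tangent_space A x \<Longrightarrow> w \<in> tangent_space A x \<Longrightarrow>
        h x (tv_add (tv_scale a u) (tv_scale b v)) w = a * h x u w + b * h x v w"
    and "u \<in> tangent_space A x \<Longrightarrow> u \<noteq> tv_zero \<Longrightarrow> h x u u > 0"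
    and "c \<in> A \<Longrightarrow> Ck_on m (cimg c)
        (\<lambda>p. h (cinv c p) (coord_vec A c (cinv c p) e) (coord_vec A c (cinv c p) e'))"
  using h unfolding riemannian_metric_def by blast+

lemma metric_coord_expansion:
  assumes h: "riemannian_metric A m h" and c: "c \<in> charts_at A x"
  shows "h x (coord_vec A c x a) (coord_vec A c x b) =
    (\<Sum>i\<in>Basis. (a \<bullet> i) *\<^sub>R (\<Sum>j\<in>Basis. (b \<bullet> j) *\<^sub>R h x (coord_vec A c x i) (coord_vec A c x j)))"
proof -
  note T = coord_vec_in_tangent_space[OF c]
  have comb: "coord_vec A c x (s *\<^sub>R e + t *\<^sub>R e') =
      tv_add (tv_scale s (coord_vec A c x e)) (tv_scale t (coord_vec A c x e'))" for s t e e'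
    using tangent_space_lincomb[OF T T, of s e t e']
    by (intro tangent_eqI[OF T _ c]) (simp_all add: tv_add_def tv_scale_def coord_vec_self[OF c])
  have lin: "linear (\<lambda>e. h x (coord_vec A c x e) w)" if w: "w \<in> tangent_space A x" for w
  proof (rule linearI)
    show "h x (coord_vec A c x (e + e')) w = h x (coord_vec A c x e) w + h x (coord_vec A c x e') w" for e e'
      using riemannian_metricD(3)[OF h T[of e] T[of e'] w, of 1 1] comb[of 1 e 1 e'] by simp
    show "h x (coord_vec A c x (s *\<^sub>R e)) w = s *\<^sub>R h x (coord_vec A c x e) w" for s e
      using riemannian_metricD(3)[OF h T[of e] T[of e] w, of s 0] comb[of s e 0 e] by simp
  qed
  have right: "h x (coord_vec A c x i) (coord_vec A c x b) =
      (\<Sum>j\<in>Basis. (b \<bullet> j) *\<^sub>R h x (coord_vec A c x i) (coord_vec A c x j))" for i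
    unfolding riemannian_metricD(2)[OF h T T, of i] by (rule linear_euclidean_expansion[OF lin[OF T]])
  have "h x (coord_vec A c x a) (coord_vec A c x b) =
      (\<Sum>i\<in>Basis. (a \<bullet> i) *\<^sub>R h x (coord_vec A c x i) (coord_vec A c x b))"
    by (rule linear_euclidean_expansion[OF lin[OF T]])
  then show ?thesis by (simp only: right)
qed

text \<open>The tangent map of \<open>f\<close> is an isometry from \<open>h\<close> to the pullback of \<open>h\<close> by the inverse; therefore the Anosov
estimates keep their constants.\<close>

lemma metric_norm_pullback:
  assumes x: "x \<in> topspace T" and v: "v \<in> tangent_space A x"
  shows "metric_norm (pullback_metric T A g h) (f x) (tangent_map A f x v) = metric_norm h x v"
  using tangent_map_in_tangent_space[OF C1_f x v] f_in[OF x]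
  by (simp add: metric_norm_def pullback_metric_def g_f[OF x] tangent_map_inverse[OF x v])

text \<open>In coordinates the coefficients of the pullback are polynomial in the first derivatives of \<open>g\<close>, and
linear in the coefficients of \<open>h\<close> composed with \<open>g\<close>. They are of class \<open>C\<^sup>r\<close> because \<open>g\<close> is of class \<open>C\<^bsup>r+1\<^esup>\<close>.\<close>

lemma pullback_riemannian_metric:
  assumes h: "riemannian_metric A r h"
  shows "riemannian_metric A r (pullback_metric T A g h)"
proof -
  let ?h = "pullback_metric T A g h"
  note hD = riemannian_metricD[OF h]
  have eq: "?h x u v = h (g x) (tangent_map A g x u) (tangent_map A g x v)"
    if "x \<in> topspace T" "u \<in> tangent_space A x" "v \<in> tangent_space A x" for x u v
    using that by (simp add: pullback_metric_def)
  have out: "?h x u v = 0" if "x \<notin> topspace T" for x u v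
    using that by (simp add: pullback_metric_def)
  note Tg = tangent_map_in_tangent_space[OF C1_g]
  have comb: "tv_add (tv_scale a u) (tv_scale b v) \<in> tangent_space A x"
    if "u \<in> tangent_space A x" "v \<in> tangent_space A x" for a b u v x
    using tangent_space_lincomb[OF that] by (simp add: tv_add_def tv_scale_def)
  have "?h x u v = 0" if "\<not> (u \<in> tangent_space A x \<and> v \<in> tangent_space A x)" for x u v
    using that by (auto simp: pullback_metric_def)
  moreover have "?h x u v = ?h x v u" if "u \<in> tangent_space A x" "v \<in> tangent_space A x" for x u v
    using that by (cases "x \<in> topspace T") (simp_all add: eq out hD(2)[OF Tg Tg])
  moreover have "?h x (tv_add (tv_scale a u) (tv_scale b v)) w = a * ?h x u w + b * ?h x v w"
    if uvw: "u \<in> tangent_space A x" "v \<in> tangent_space A x" "w \<in> tangent_space A x" for x u v w a b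
  proof (cases "x \<in> topspace T")
    case True
    have "tangent_map A g x (tv_add (tv_scale a u) (tv_scale b v)) =
        tv_add (tv_scale a (tangent_map A g x u)) (tv_scale b (tangent_map A g x v))"
      using tangent_map_lincomb[OF C1_g True uvw(1,2)] by (simp add: tv_add_def tv_scale_def)
    then show ?thesis
      using hD(3)[OF Tg[OF True uvw(1)] Tg[OF True uvw(2)] Tg[OF True uvw(3)]]
      by (simp add: eq[OF True] comb uvw)
  qed (simp add: out)
  moreover have "?h x u u > 0" if u: "u \<in> tangent_space A x" "u \<noteq> tv_zero" for x u
  proof -
    interpret inv: manifold_diffeo T A r g f by (rule inverse_diffeo)
    have x: "x \<in> topspace T" using u tangent_space_outside by blast
    have "tangent_map A g x u \<noteq> tv_zero"
    proof
      assume "tangent_map A g x u = tv_zero"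
      then have "u = tangent_map A f (g x) tv_zero" using inv.tangent_map_inverse[OF x u(1)] by simp
      then show False
        using u(2) tangent_map_zero[OF C1_f g_in[OF x]] by (simp add: tv_zero_def)
    qed
    then show ?thesis using hD(4)[OF Tg[OF x u(1)]] by (simp add: eq[OF x u(1) u(1)])
  qed
  moreover have "Ck_on r (cimg c') (\<lambda>p. ?h (cinv c' p) (coord_vec A c' (cinv c' p) a) (coord_vec A c' (cinv c' p) b))"
    (is "Ck_on r _ ?H") if c': "c' \<in> A" for c' a b
  proof (rule Ck_on_local)
    fix p assume "p \<in> cimg c'"
    then obtain y where y: "y \<in> cdom c'" "p = cmap c' y" by blast
    have "y \<in> topspace T" using y cdom_subset[OF c'] by blast
    then obtain c where "c \<in> charts_at A (g y)" using charts_at_ex g_in by blast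
    then have c: "c \<in> A" "g y \<in> cdom c" by (simp_all add: charts_at_iff)
    let ?W = "coord_dom g c' c" and ?\<psi> = "coord_expr g c' c"
    have W: "open ?W" by (rule open_coord_dom[OF Ck_mapD(1)[OF Ck_g] c' c(1)])
    have \<psi>: "Ck_on (Suc r) ?W ?\<psi>" by (rule Ck_mapD(3)[OF Ck_g c' c(1)])
    let ?k = "\<lambda>i j p. h (cinv c p) (coord_vec A c (cinv c p) i) (coord_vec A c (cinv c p) j)"
    let ?D = "\<lambda>a p. frechet_derivative ?\<psi> (at p) a"
    have "Ck_on r ?W (?k i j \<circ> ?\<psi>)" for i j
      by (rule Ck_on_compose[OF W hD(5)[OF c(1)] Ck_on_SucD(3)[OF \<psi>]])
         (use c' in \<open>auto simp: coord_dom_def coord_expr_def cinv_cmap\<close>)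
    moreover have "Ck_on r ?W (\<lambda>p. ?D a p \<bullet> i)" for a i
      by (rule Ck_on_bounded_linear[OF bounded_linear_inner_left W Ck_on_SucD(2)[OF \<psi>]])
    ultimately have "Ck_on r ?W (\<lambda>p. \<Sum>i\<in>Basis. (?D a p \<bullet> i) *\<^sub>R
        (\<Sum>j\<in>Basis. (?D b p \<bullet> j) *\<^sub>R (?k i j \<circ> ?\<psi>) p))"
      by (intro Ck_on_sum[OF W] finite_Basis Ck_on_scaleR[OF W])
    moreover have "?H q = (\<Sum>i\<in>Basis. (?D a q \<bullet> i) *\<^sub>R
        (\<Sum>j\<in>Basis. (?D b q \<bullet> j) *\<^sub>R (?k i j \<circ> ?\<psi>) q))" if q: "q \<in> ?W" for q
    proof -
      obtain z where z: "z \<in> cdom c'" "g z \<in> cdom c" "q = cmap c' z"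
        using q by (auto simp: coord_dom_def)
      have cz: "cinv c' q = z" "?\<psi> q = cmap c (g z)" "cinv c (?\<psi> q) = g z"
        using z c c' by (simp_all add: coord_expr_def cinv_cmap)
      have zT: "z \<in> topspace T" using z cdom_subset[OF c'] by blast
      have ch: "c' \<in> charts_at A z" "c \<in> charts_at A (g z)" using z c c' by (simp_all add: charts_at_iff)
      note vT = coord_vec_in_tangent_space[OF ch(1)]
      have "tangent_map A g z (coord_vec A c' z e) = coord_vec A c (g z) (?D e q)" for e
        by (rule tangent_eqI[OF Tg[OF zT vT] coord_vec_in_tangent_space[OF ch(2)] ch(2)])
           (simp add: tangent_map_coord[OF C1_g vT ch] coord_vec_self ch z(3))
      then have "?H q = h (g z) (coord_vec A c (g z) (?D a q)) (coord_vec A c (g z) (?D b q))"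
        by (simp add: cz eq[OF zT vT vT])
      then show ?thesis
        unfolding metric_coord_expansion[OF h ch(2), of "?D a q" "?D b q"]
        by (simp add: cz cinv_cmap[OF c(1) z(2)])
    qed
    ultimately have "Ck_on r ?W ?H" by (subst Ck_on_cong[OF W])
    moreover have "p \<in> ?W" using y c by (auto simp: coord_dom_def)
    ultimately show "\<exists>U. open U \<and> p \<in> U \<and> Ck_on r U ?H" using W by blast
  qed
  ultimately show ?thesis
    unfolding riemannian_metric_def by (intro conjI allI ballI impI)
qed

text \<open>The witnesses are the conjugate flow, the images of the two bundles, the pullback of the auxiliary
metric by the inverse, and the old constants.\<close>

lemma pushforward_Anosov:
  assumes r: "r \<ge> 1" and X: "X \<in> Anosov_fields T A r"
  shows "pushforward T A f X \<in> Anosov_fields T A r"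
proof -
  obtain \<phi> Es Eu h C l where XC: "X \<in> Cr_fields A r" and flow: "flow_of T A r X \<phi>"
    and split: "flow_splitting T A X Es Eu"
    and inv: "\<forall>t. \<forall>x\<in>topspace T. tangent_map A (\<phi> t) x ` Es x = Es (\<phi> t x) \<and>
           tangent_map A (\<phi> t) x ` Eu x = Eu (\<phi> t x)"
    and h: "riemannian_metric A r h" and Cl: "(C::real) > 0" "(l::real) > 0"
    and hyp: "\<forall>t>0. \<forall>x\<in>topspace T.
           (\<forall>v\<in>Es x. metric_norm h (\<phi> t x) (tangent_map A (\<phi> t) x v)
              \<le> C * exp (- l * t) * metric_norm h x v) \<and>
           (\<forall>v\<in>Eu x. metric_norm h (\<phi> (- t) x) (tangent_map A (\<phi> (- t)) x v)
              \<le> C * exp (- l * t) * metric_norm h x v)"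
    using X unfolding Anosov_fields_def mem_Collect_eq by (elim conjE exE) (rule that)
  let ?X = "pushforward T A f X" and ?\<phi> = "\<lambda>t. f \<circ> \<phi> t \<circ> g" and ?h = "pullback_metric T A g h"
  let ?push = "\<lambda>E y. tangent_map A f (g y) ` E (g y)"
  have \<phi>r: "Ck_map T A r (\<phi> t)" for t using flow unfolding flow_of_def by blast
  have \<phi>1: "Ck_map T A 1 (\<phi> t)" for t by (rule Ck_map_mono[OF \<phi>r r])
  note \<phi>_in = Ck_mapD(2)[OF \<phi>1]
  have sub: "Es x \<subseteq> tangent_space A x" "Eu x \<subseteq> tangent_space A x" if "x \<in> topspace T" for x
    using split that unfolding flow_splitting_def by (auto dest: subbundle_subset)
  have invariant: "tangent_map A (?\<phi> t) y ` ?push E y = ?push E (?\<phi> t y)"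
    if E: "E (g y) \<subseteq> tangent_space A (g y)" and y: "y \<in> topspace T"
      and inv: "tangent_map A (\<phi> t) (g y) ` E (g y) = E (\<phi> t (g y))" for E t y
  proof -
    have "tangent_map A (?\<phi> t) y ` ?push E y = (\<lambda>v. tangent_map A (?\<phi> t) y (tangent_map A f (g y) v)) ` E (g y)"
      by (rule image_image)
    also have "\<dots> = (\<lambda>v. tangent_map A f (\<phi> t (g y)) (tangent_map A (\<phi> t) (g y) v)) ` E (g y)"
      by (rule image_cong[OF refl], rule conjugate_tangent_map[OF \<phi>1 y], rule subsetD[OF E])
    also have "\<dots> = tangent_map A f (\<phi> t (g y)) ` E (\<phi> t (g y))"
      unfolding inv[symmetric] by (rule image_image[symmetric])
    finally show ?thesis using g_f[OF \<phi>_in[OF g_in[OF y]]] by simp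
  qed
  have norm: "metric_norm ?h (?\<phi> t y) (tangent_map A (?\<phi> t) y v') \<le> K * metric_norm ?h y v'"
    if y: "y \<in> topspace T" and v': "v' \<in> ?push E y" and E: "E (g y) \<subseteq> tangent_space A (g y)"
      and bound: "\<And>v. v \<in> E (g y) \<Longrightarrow>
        metric_norm h (\<phi> t (g y)) (tangent_map A (\<phi> t) (g y) v) \<le> K * metric_norm h (g y) v" for y v' E t K
  proof -
    obtain v where v: "v \<in> E (g y)" "v' = tangent_map A f (g y) v" using v' by blast
    note gy = g_in[OF y] and vT = subsetD[OF E v(1)]
    have "metric_norm ?h (?\<phi> t y) (tangent_map A (?\<phi> t) y v') =
        metric_norm ?h (f (\<phi> t (g y))) (tangent_map A f (\<phi> t (g y)) (tangent_map A (\<phi> t) (g y) v))"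
      unfolding v(2) conjugate_tangent_map[OF \<phi>1 y vT] by simp
    also have "\<dots> = metric_norm h (\<phi> t (g y)) (tangent_map A (\<phi> t) (g y) v)"
      by (rule metric_norm_pullback[OF \<phi>_in[OF gy] tangent_map_in_tangent_space[OF \<phi>1 gy vT]])
    also have "\<dots> \<le> K * metric_norm h (g y) v" by (rule bound[OF v(1)])
    also have "metric_norm h (g y) v = metric_norm ?h y v'"
      using metric_norm_pullback[OF gy vT, of h] by (simp add: v(2) f_g[OF y])
    finally show ?thesis .
  qed
  have "\<forall>t. \<forall>y\<in>topspace T. tangent_map A (?\<phi> t) y ` ?push Es y = ?push Es (?\<phi> t y) \<and>
      tangent_map A (?\<phi> t) y ` ?push Eu y = ?push Eu (?\<phi> t y)"
    using inv by (intro allI ballI conjI invariant sub g_in) (simp_all add: g_in)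
  moreover have "\<forall>t>0. \<forall>y\<in>topspace T.
      (\<forall>v\<in>?push Es y. metric_norm ?h (?\<phi> t y) (tangent_map A (?\<phi> t) y v)
         \<le> C * exp (- l * t) * metric_norm ?h y v) \<and>
      (\<forall>v\<in>?push Eu y. metric_norm ?h (?\<phi> (- t) y) (tangent_map A (?\<phi> (- t)) y v)
         \<le> C * exp (- l * t) * metric_norm ?h y v)"
  proof (intro allI impI ballI conjI)
    fix t :: real and y v assume t: "t > 0" and y: "y \<in> topspace T"
    note bound = hyp[rule_format, OF t g_in[OF y]]
    show "v \<in> ?push Es y \<Longrightarrow> metric_norm ?h (?\<phi> t y) (tangent_map A (?\<phi> t) y v)
         \<le> C * exp (- l * t) * metric_norm ?h y v"
      by (rule norm[where E=Es, OF y _ sub(1)[OF g_in[OF y]]]) (use bound in blast)+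
    show "v \<in> ?push Eu y \<Longrightarrow> metric_norm ?h (?\<phi> (- t) y) (tangent_map A (?\<phi> (- t)) y v)
         \<le> C * exp (- l * t) * metric_norm ?h y v"
      by (rule norm[where E=Eu, OF y _ sub(2)[OF g_in[OF y]]]) (use bound in blast)+
  qed
  ultimately have "flow_of T A r ?X ?\<phi> \<and> flow_splitting T A ?X (?push Es) (?push Eu) \<and>
      (\<forall>t. \<forall>y\<in>topspace T. tangent_map A (?\<phi> t) y ` ?push Es y = ?push Es (?\<phi> t y) \<and>
        tangent_map A (?\<phi> t) y ` ?push Eu y = ?push Eu (?\<phi> t y)) \<and>
      riemannian_metric A r ?h \<and> C > 0 \<and> l > 0 \<and>
      (\<forall>t>0. \<forall>y\<in>topspace T.
      (\<forall>v\<in>?push Es y. metric_norm ?h (?\<phi> t y) (tangent_map A (?\<phi> t) y v)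
         \<le> C * exp (- l * t) * metric_norm ?h y v) \<and>
      (\<forall>v\<in>?push Eu y. metric_norm ?h (?\<phi> (- t) y) (tangent_map A (?\<phi> (- t)) y v)
         \<le> C * exp (- l * t) * metric_norm ?h y v))"
    by (intro conjI pushforward_flow[OF flow] pushforward_flow_splitting[OF split]
        pullback_riemannian_metric[OF h] Cl Cr_fieldsD(1)[OF XC])
  then show ?thesis
    unfolding Anosov_fields_def mem_Collect_eq
    by (intro conjI[OF pushforward_Cr_fields[OF XC]] exI[of _ ?\<phi>] exI[of _ "?push Es"]
        exI[of _ "?push Eu"] exI[of _ ?h] exI[of _ C] exI[of _ l])
qed

end

section \<open>Paths of Anosov fields and the distance\<close>

context manifold_atlas
begin

lemma Cr_fields_lincomb:
  assumes X: "X \<in> Cr_fields A r" and Y: "Y \<in> Cr_fields A r"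
  shows "(\<lambda>x c. a *\<^sub>R X x c + b *\<^sub>R Y x c) \<in> Cr_fields A r"
proof -
  have "(\<lambda>c. a *\<^sub>R X x c + b *\<^sub>R Y x c) \<in> tangent_space A x" for x
    using X Y unfolding Cr_fields_def by (intro tangent_space_lincomb) blast+
  moreover have "Ck_on r (cimg c) (local_rep c (\<lambda>x c. a *\<^sub>R X x c + b *\<^sub>R Y x c))" if c: "c \<in> A" for c
  proof -
    have "Ck_on r (cimg c) (local_rep c X)" "Ck_on r (cimg c) (local_rep c Y)"
      using X Y c unfolding Cr_fields_def by blast+
    then have "Ck_on r (cimg c) (\<lambda>p. a *\<^sub>R local_rep c X p + b *\<^sub>R local_rep c Y p)"
      by (intro Ck_on_add Ck_on_bounded_linear[OF bounded_linear_scaleR_right] open_cimg[OF c])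
    then show ?thesis by (simp add: local_rep_def)
  qed
  ultimately show ?thesis unfolding Cr_fields_def by blast
qed

lemma Cr_tendsto_cong:
  assumes "Cr_tendsto A r F X G" and eq: "\<forall>\<^sub>F s in G. F s = F' s"
  shows "Cr_tendsto A r F' X G"
  unfolding Cr_tendsto_iff_Ck_lim
proof
  fix c assume c: "c \<in> A"
  have "\<forall>\<^sub>F s in G. \<forall>p\<in>cimg c. local_rep c (F s) p = local_rep c (F' s) p"
    using eq by eventually_elim simp
  moreover have "Ck_lim r (cimg c) (\<lambda>s. local_rep c (F s)) (local_rep c X) G"
    using assms(1) c unfolding Cr_tendsto_iff_Ck_lim by blast
  ultimately show "Ck_lim r (cimg c) (\<lambda>s. local_rep c (F' s)) (local_rep c X) G"
    by (rule Ck_lim_cong[OF open_cimg[OF c] _ refl, THEN iffD1])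
qed

end

context manifold_diffeo
begin

lemma pushforward_path:
  assumes r: "r \<ge> 1" and path: "Anosov_C1_path T A r P P'"
  shows "Anosov_C1_path T A r (\<lambda>s. pushforward T A f (P s)) (\<lambda>s. pushforward T A f (P' s))"
  unfolding Anosov_C1_path_def
proof (intro ballI conjI)
  let ?pf = "pushforward T A f"
  fix s :: real assume s: "s \<in> {0..1}"
  let ?G = "at s within {0..1}"
  have P: "P t \<in> Anosov_fields T A r" "P' t \<in> Cr_fields A r" if "t \<in> {0..1}" for t
    using path that unfolding Anosov_C1_path_def by blast+
  have PC: "P t \<in> Cr_fields A r" if "t \<in> {0..1}" for t
    using P(1)[OF that] unfolding Anosov_fields_def by blast
  have lim: "Cr_tendsto A r (\<lambda>t x c. (P t x c - P s x c) /\<^sub>R (t - s)) (P' s) ?G"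
    "Cr_tendsto A r P' (P' s) ?G"
    using path s unfolding Anosov_C1_path_def by blast+
  \<comment> \<open>Outside of the unit interval nothing is known about \<open>P\<close>, so that the difference quotients are vector
    fields of class \<open>C\<^sup>r\<close> only eventually.\<close>
  have unit: "\<forall>\<^sub>F t in ?G. t \<in> {0..1}" by (simp add: eventually_at_filter)
  have quot: "(\<lambda>x c. (X x c - Y x c) /\<^sub>R h) = (\<lambda>x c. inverse h *\<^sub>R X x c + (- inverse h) *\<^sub>R Y x c)"
    for X Y :: "('a, 'e) vfield" and h
    by (simp add: algebra_simps)
  show "?pf (P s) \<in> Anosov_fields T A r" by (rule pushforward_Anosov[OF r P(1)[OF s]])
  show "?pf (P' s) \<in> Cr_fields A r" by (rule pushforward_Cr_fields[OF P(2)[OF s]])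
  have "\<forall>\<^sub>F t in ?G. (\<lambda>x c. (P t x c - P s x c) /\<^sub>R (t - s)) \<in> Cr_fields A r"
    using unit by eventually_elim (unfold quot, rule Cr_fields_lincomb[OF PC PC[OF s]])
  from pushforward_Cr_tendsto[OF lim(1) this P(2)[OF s]]
  show "Cr_tendsto A r (\<lambda>t x c. (?pf (P t) x c - ?pf (P s) x c) /\<^sub>R (t - s)) (?pf (P' s)) ?G"
  proof (rule Cr_tendsto_cong)
    show "\<forall>\<^sub>F t in ?G. ?pf (\<lambda>x c. (P t x c - P s x c) /\<^sub>R (t - s)) =
        (\<lambda>x c. (?pf (P t) x c - ?pf (P s) x c) /\<^sub>R (t - s))"
      using unit
    proof eventually_elim
      case (elim t)
      show ?case
        unfolding quot
        by (intro ext pushforward_lincomb Cr_fieldsD(1)[OF PC[OF elim]] Cr_fieldsD(1)[OF PC[OF s]])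
    qed
  qed
  have "\<forall>\<^sub>F t in ?G. P' t \<in> Cr_fields A r" using unit by eventually_elim (rule P(2))
  from pushforward_Cr_tendsto[OF lim(2) this P(2)[OF s]]
  show "Cr_tendsto A r (\<lambda>s. ?pf (P' s)) (?pf (P' s)) ?G" .
qed

text \<open>The pushforward of a path has the same length, so the infimum on the left is taken over a set that
contains all lengths occurring on the right.\<close>

lemma hofer_dist_pushforward_le:
  assumes r: "r \<ge> 1" and N: "\<And>Y. Y \<in> Cr_fields A r \<Longrightarrow> N' (pushforward T A f Y) = N Y"
  shows "hofer_dist T A r N' (pushforward T A f X) (pushforward T A f Z) \<le> hofer_dist T A r N X Z"
  unfolding hofer_dist_def
proof (rule Inf_superset_mono, rule subsetI, elim CollectE exE conjE)
  fix L P P'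
  assume L: "L = (\<integral>\<^sup>+ s\<in>{0..1}. ennreal (N (P' s)) \<partial>lborel)"
    and path: "Anosov_C1_path T A r P P'" and ends: "P 0 = X" "P 1 = Z"
  have "N' (pushforward T A f (P' s)) = N (P' s)" if "s \<in> {0..1}" for s
    using path that N unfolding Anosov_C1_path_def by blast
  then have "L = (\<integral>\<^sup>+ s\<in>{0..1}. ennreal (N' (pushforward T A f (P' s))) \<partial>lborel)"
    unfolding L by (intro nn_integral_cong) (simp split: split_indicator)
  then show "L \<in> {\<integral>\<^sup>+ s\<in>{0..1}. ennreal (N' (P' s)) \<partial>lborel | P P'.
      Anosov_C1_path T A r P P' \<and> P 0 = pushforward T A f X \<and> P 1 = pushforward T A f Z}"
    using pushforward_path[OF r path] ends
    by (intro CollectI exI[of _ "\<lambda>s. pushforward T A f (P s)"]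
        exI[of _ "\<lambda>s. pushforward T A f (P' s)"]) simp
qed

text \<open>The inverse diffeomorphism satisfies the same assumption with \<open>N\<close> and \<open>N'\<close> exchanged, and its pushforward
undoes that of \<open>f\<close>; so the inequality just proved holds in both directions.\<close>

lemma hofer_dist_pushforward:
  assumes r: "r \<ge> 1" and N: "\<And>Y. Y \<in> Cr_fields A r \<Longrightarrow> N' (pushforward T A f Y) = N Y"
    and X: "X \<in> Cr_fields A r" and Z: "Z \<in> Cr_fields A r"
  shows "hofer_dist T A r N' (pushforward T A f X) (pushforward T A f Z) = hofer_dist T A r N X Z"
proof (rule antisym)
  show "hofer_dist T A r N' (pushforward T A f X) (pushforward T A f Z) \<le> hofer_dist T A r N X Z"
    using r N by (rule hofer_dist_pushforward_le)
  interpret inv: manifold_diffeo T A r g f by (rule inverse_diffeo)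
  have N': "N (pushforward T A g Y) = N' Y" if Y: "Y \<in> Cr_fields A r" for Y
    using N[OF inv.pushforward_Cr_fields[OF Y]] inv.pushforward_inverse[OF Cr_fieldsD(1)[OF Y]] by simp
  have undo: "pushforward T A g (pushforward T A f Y) = Y" if "Y \<in> Cr_fields A r" for Y
    by (rule pushforward_inverse[OF Cr_fieldsD(1)[OF that]])
  show "hofer_dist T A r N X Z \<le> hofer_dist T A r N' (pushforward T A f X) (pushforward T A f Z)"
    using inv.hofer_dist_pushforward_le[of N N' "pushforward T A f X" "pushforward T A f Z", OF r N']
    unfolding undo[OF X] undo[OF Z] .
qed

end

lemma manifold_diffeo_inv_into:
  assumes "smooth_manifold T A" and f: "Ck_diffeo T A k f" and k: "k \<ge> r + 1"
  shows "manifold_diffeo T A r f (inv_into (topspace T) f)"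
proof -
  interpret manifold_atlas T A by unfold_locales (rule assms(1))
  have bij: "bij_betw f (topspace T) (topspace T)"
    and Ck: "Ck_map T A k f" "Ck_map T A k (inv_into (topspace T) f)"
    using f unfolding Ck_diffeo_def by blast+
  show ?thesis
  proof unfold_locales
    show "Ck_map T A (Suc r) f" "Ck_map T A (Suc r) (inv_into (topspace T) f)"
      using Ck k by (auto intro: Ck_map_mono)
  qed (use bij in \<open>simp_all add: bij_betw_inv_into_left bij_betw_inv_into_right\<close>)
qed

theorem proposition5p2:
  fixes T :: "'a topology"
    and A :: "('a, 'e::euclidean_space) chart set"
    and r k :: nat
    and g :: "('a, 'e) metric_tensor"
    and f :: "'a \<Rightarrow> 'a"
    and V :: "('a, 'e) metric_tensor \<Rightarrow> ('a, 'e) vfield \<Rightarrow> real"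
  assumes "smooth_manifold T A" and "compact_space T"
    and "r \<ge> 1"
    and "riemannian_metric A r g"
    and "k \<ge> r + 1" and "Ck_diffeo T A k f"
    and "norm_on (Cr_fields A r) (V g)"
    and "norm_on (Cr_fields A r) (V (pullback_metric T A f g))"
    and "\<And>Y. Y \<in> Cr_fields A r \<Longrightarrow>
           V (pullback_metric T A f g) (pushforward T A f Y) = V g Y"
  shows "\<forall>X\<in>Anosov_fields T A r. \<forall>Z\<in>Anosov_fields T A r.
           hofer_dist T A r (V (pullback_metric T A f g)) (pushforward T A f X) (pushforward T A f Z)
             = hofer_dist T A r (V g) X Z"
proof (intro ballI)
  fix X Z assume "X \<in> Anosov_fields T A r" "Z \<in> Anosov_fields T A r"
  then have "X \<in> Cr_fields A r" "Z \<in> Cr_fields A r"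
    unfolding Anosov_fields_def by blast+
  with assms(3,9)
  show "hofer_dist T A r (V (pullback_metric T A f g)) (pushforward T A f X) (pushforward T A f Z)
      = hofer_dist T A r (V g) X Z"
    by (rule manifold_diffeo.hofer_dist_pushforward[OF manifold_diffeo_inv_into[OF assms(1,6,5)]])
qed

end
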